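(* Let $(M,\omega)$ be a symplectic manifold without boundary with $\dim M = 2$, and let $p \in [1,\infty)$. Then for all $F,G \in C^\infty_c(M)$ we have $$\liminf_{\overline F \xrightarrow{C^0} F,\ \overline G \xrightarrow{C^0} G} \|\{\overline F,\overline G\}\|_{L^p(M)} = \|\{F,G\}\|_{L^p(M)},$$ where $\overline F,\overline G$ range over $C^\infty_c(M)$; that is, $$\sup_{\delta>0}\ \inf\Big\{\|\{\overline F,\overline G\}\|_{L^p(M)} \ :\ \overline F,\overline G\in C^\infty_c(M),\ \|\overline F-F\|_{C^0}\le\delta,\ \|\overline G-G\|_{C^0}\le\delta\Big\} = \|\{F,G\}\|_{L^p(M)}.$$
   Context: Manifolds are smooth, paracompact and second countable. $C^\infty_c(M)$ denotes the space of smooth compactly supported real-valued functions on $M$, and $\|H\|_{C^0}=\sup_M|H|$; $\xrightarrow{C^0}$ denotes convergence in this norm. For $H\in C^\infty(M)$ the Hamiltonian vector field $X_H$ is defined by $\omega(X_H,\cdot)=-dH$. The Poisson bracket of $F,G\in C^\infty(M)$ is the function $\{F,G\}=-\omega(X_F,X_G)=dF(X_G)$. For a measurable subset $X\subset M$ and a function $H$ on $X$, $\|H\|_{L^p(X)}=\big(\int_X|H|^p\,\omega\big)^{1/p}$ denotes the $L^p$-norm with respect to the (positive) measure induced by $\omega$. *)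

theory Defs
  imports "HOL-Analysis.Analysis"
begin

section \<open>Smooth maps between open subsets of Euclidean spaces\<close>

text \<open>The predicates below are intended for open \<open>S\<close> only; the values of \<open>f\<close> outside \<open>S\<close> are then
  irrelevant.\<close>

primrec Ck_on :: "nat \<Rightarrow> 'a::euclidean_space set \<Rightarrow> ('a \<Rightarrow> 'b::real_normed_vector) \<Rightarrow> bool" where
  "Ck_on 0 S f \<longleftrightarrow> continuous_on S f"
| "Ck_on (Suc k) S f \<longleftrightarrow> (\<forall>x\<in>S. f differentiable (at x)) \<and>
     (\<forall>v. Ck_on k S (\<lambda>x. frechet_derivative f (at x) v))"

definition smooth_on :: "'a::euclidean_space set \<Rightarrow> ('a \<Rightarrow> 'b::real_normed_vector) \<Rightarrow> bool" where
  "smooth_on S f \<longleftrightarrow> (\<forall>k. Ck_on k S f)"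

section \<open>Smooth manifolds without boundary\<close>

text \<open>A chart is a pair \<open>(U, \<phi>)\<close> of a domain and a coordinate map; \<open>\<phi>\<close> is unconstrained outside
  \<open>U\<close>. The underlying topological space of a manifold is a whole type, and the model space
  \<open>'e\<close> fixes its dimension. Hausdorffness and second countability are class
  constraints on \<open>'m\<close> (together with the atlas they imply paracompactness). An atlas is
  not required to be maximal: smoothness of functions and forms depends only on the maximal atlas
  it generates.\<close>

type_synonym ('m, 'e) chart = "'m set \<times> ('m \<Rightarrow> 'e)"

abbreviation chart_dom :: "('m, 'e) chart \<Rightarrow> 'm set" where
  "chart_dom c \<equiv> fst c"

abbreviation chart_map :: "('m, 'e) chart \<Rightarrow> 'm \<Rightarrow> 'e" where
  "chart_map c \<equiv> snd c"

definition chart_inv :: "('m, 'e) chart \<Rightarrow> 'e \<Rightarrow> 'm" where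
  "chart_inv c = inv_into (chart_dom c) (chart_map c)"

definition transition :: "('m, 'e) chart \<Rightarrow> ('m, 'e) chart \<Rightarrow> 'e \<Rightarrow> 'e" where
  "transition c d = chart_map d \<circ> chart_inv c"

definition smooth_atlas ::
  "('m::{t2_space, second_countable_topology}, 'e::euclidean_space) chart set \<Rightarrow> bool" where
  "smooth_atlas A \<longleftrightarrow>
     (\<Union>c\<in>A. chart_dom c) = UNIV \<and>
     (\<forall>c\<in>A. open (chart_dom c) \<and> open (chart_map c ` chart_dom c) \<and>
        homeomorphism (chart_dom c) (chart_map c ` chart_dom c) (chart_map c) (chart_inv c)) \<and>
     (\<forall>c\<in>A. \<forall>d\<in>A. smooth_on (chart_map c ` (chart_dom c \<inter> chart_dom d)) (transition c d))"

definition charts_at :: "('m, 'e) chart set \<Rightarrow> 'm \<Rightarrow> ('m, 'e) chart set" where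
  "charts_at A q = {c \<in> A. q \<in> chart_dom c}"

definition smooth_fun ::
  "('m::{t2_space, second_countable_topology}, 'e::euclidean_space) chart set \<Rightarrow>
   ('m \<Rightarrow> real) \<Rightarrow> bool" where
  "smooth_fun A H \<longleftrightarrow> (\<forall>c\<in>A. smooth_on (chart_map c ` chart_dom c) (H \<circ> chart_inv c))"

definition smooth_compact_support ::
  "('m::{t2_space, second_countable_topology}, 'e::euclidean_space) chart set \<Rightarrow>
   ('m \<Rightarrow> real) set" where
  "smooth_compact_support A = {H. smooth_fun A H \<and> compact (closure (support_on UNIV H))}"

definition C0_norm :: "('m \<Rightarrow> real) \<Rightarrow> real" where
  "C0_norm H = (SUP x. \<bar>H x\<bar>)"

section \<open>Tangent vectors\<close>

text \<open>A tangent vector at \<open>q\<close> is the family of its coordinate vectors, one for each chart around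
  \<open>q\<close>, related by the derivatives of the transition maps. At charts that do not contain \<open>q\<close> the
  family is set to \<open>0\<close>, so that equality of tangent vectors is equality of families.\<close>

type_synonym ('m, 'e) tangent = "('m, 'e) chart \<Rightarrow> 'e"

definition tangent_space ::
  "('m, 'e::euclidean_space) chart set \<Rightarrow> 'm \<Rightarrow> ('m, 'e) tangent set" where
  "tangent_space A q = {v.
     (\<forall>c\<in>charts_at A q. \<forall>d\<in>charts_at A q.
        v d = frechet_derivative (transition c d) (at (chart_map c q)) (v c)) \<and>
     (\<forall>c. c \<notin> charts_at A q \<longrightarrow> v c = 0)}"

text \<open>The tangent vector at \<open>q\<close> whose coordinate vector in the chart \<open>c\<close> is \<open>a\<close>.\<close>

definition coord_tangent ::
  "('m, 'e::euclidean_space) chart set \<Rightarrow> ('m, 'e) chart \<Rightarrow> 'm \<Rightarrow> 'e \<Rightarrow> ('m, 'e) tangent" where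
  "coord_tangent A c q a = (\<lambda>d. if d \<in> charts_at A q
     then frechet_derivative (transition c d) (at (chart_map c q)) a else 0)"

text \<open>By the chain rule the value below does not depend on the selected chart.\<close>

definition differential ::
  "('m, 'e::euclidean_space) chart set \<Rightarrow> ('m \<Rightarrow> real) \<Rightarrow> 'm \<Rightarrow> ('m, 'e) tangent \<Rightarrow> real" where
  "differential A H q v = (let c = (SOME c. c \<in> charts_at A q) in
     frechet_derivative (H \<circ> chart_inv c) (at (chart_map c q)) (v c))"

section \<open>Symplectic forms\<close>

type_synonym ('m, 'e) form2 = "'m \<Rightarrow> ('m, 'e) tangent \<Rightarrow> ('m, 'e) tangent \<Rightarrow> real"

definition form_in_chart ::
  "('m, 'e::euclidean_space) chart set \<Rightarrow> ('m, 'e) form2 \<Rightarrow> ('m, 'e) chart \<Rightarrow>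
   'e \<Rightarrow> 'e \<Rightarrow> 'e \<Rightarrow> real" where
  "form_in_chart A \<omega> c x a b = (let q = chart_inv c x in
     \<omega> q (coord_tangent A c q a) (coord_tangent A c q b))"

definition two_form ::
  "('m, 'e::euclidean_space) chart set \<Rightarrow> ('m, 'e) form2 \<Rightarrow> bool" where
  "two_form A \<omega> \<longleftrightarrow>
     (\<forall>q. \<forall>u\<in>tangent_space A q. \<forall>v\<in>tangent_space A q. \<forall>w\<in>tangent_space A q. \<forall>s t.
        \<omega> q (\<lambda>c. s *\<^sub>R u c + t *\<^sub>R v c) w = s * \<omega> q u w + t * \<omega> q v w) \<and>
     (\<forall>q. \<forall>u\<in>tangent_space A q. \<forall>v\<in>tangent_space A q. \<omega> q u v = - \<omega> q v u)"

definition smooth_form ::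
  "('m, 'e::euclidean_space) chart set \<Rightarrow> ('m, 'e) form2 \<Rightarrow> bool" where
  "smooth_form A \<omega> \<longleftrightarrow>
     (\<forall>c\<in>A. \<forall>a b. smooth_on (chart_map c ` chart_dom c) (\<lambda>x. form_in_chart A \<omega> c x a b))"

text \<open>\<open>d\<omega> = 0\<close>, evaluated on constant coordinate vector fields \<open>a\<close>, \<open>b\<close>, \<open>e\<close> (whose Lie brackets
  vanish).\<close>

definition closed_form ::
  "('m, 'e::euclidean_space) chart set \<Rightarrow> ('m, 'e) form2 \<Rightarrow> bool" where
  "closed_form A \<omega> \<longleftrightarrow>
     (\<forall>c\<in>A. \<forall>x\<in>chart_map c ` chart_dom c. \<forall>a b e.
        frechet_derivative (\<lambda>y. form_in_chart A \<omega> c y b e) (at x) a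
      - frechet_derivative (\<lambda>y. form_in_chart A \<omega> c y a e) (at x) b
      + frechet_derivative (\<lambda>y. form_in_chart A \<omega> c y a b) (at x) e = 0)"

definition nondegenerate_form ::
  "('m, 'e::euclidean_space) chart set \<Rightarrow> ('m, 'e) form2 \<Rightarrow> bool" where
  "nondegenerate_form A \<omega> \<longleftrightarrow>
     (\<forall>q. \<forall>u\<in>tangent_space A q. (\<forall>v\<in>tangent_space A q. \<omega> q u v = 0) \<longrightarrow> u = (\<lambda>_. 0))"

definition symplectic_manifold ::
  "('m::{t2_space, second_countable_topology}, 'e::euclidean_space) chart set \<Rightarrow>
   ('m, 'e) form2 \<Rightarrow> bool" where
  "symplectic_manifold A \<omega> \<longleftrightarrow>
     smooth_atlas A \<and> two_form A \<omega> \<and> smooth_form A \<omega> \<and> closed_form A \<omega> \<and> nondegenerate_form A \<omega>"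

section \<open>Hamiltonian vector fields and the Poisson bracket\<close>

definition hamiltonian_vf ::
  "('m, 'e::euclidean_space) chart set \<Rightarrow> ('m, 'e) form2 \<Rightarrow> ('m \<Rightarrow> real) \<Rightarrow>
   'm \<Rightarrow> ('m, 'e) tangent" where
  "hamiltonian_vf A \<omega> H q = (THE X. X \<in> tangent_space A q \<and>
     (\<forall>v\<in>tangent_space A q. \<omega> q X v = - differential A H q v))"

definition poisson_bracket ::
  "('m, 'e::euclidean_space) chart set \<Rightarrow> ('m, 'e) form2 \<Rightarrow> ('m \<Rightarrow> real) \<Rightarrow> ('m \<Rightarrow> real) \<Rightarrow>
   'm \<Rightarrow> real" where
  "poisson_bracket A \<omega> F G q = - \<omega> q (hamiltonian_vf A \<omega> F q) (hamiltonian_vf A \<omega> G q)"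

section \<open>The area measure of a symplectic surface and \<open>L\<^sup>p\<close> norms\<close>

text \<open>The unique Borel measure which in every chart has density \<open>\<bar>\<omega>(\<partial>\<^sub>1, \<partial>\<^sub>2)\<bar>\<close> with respect to
  Lebesgue measure.\<close>

definition area_measure ::
  "('m::topological_space, real^2) chart set \<Rightarrow> ('m, real^2) form2 \<Rightarrow> 'm measure" where
  "area_measure A \<omega> = (THE \<mu>. sets \<mu> = sets borel \<and>
     (\<forall>c\<in>A. \<forall>B\<in>sets borel. B \<subseteq> chart_dom c \<longrightarrow>
        emeasure \<mu> B = (\<integral>\<^sup>+ x\<in>chart_map c ` B.
          ennreal \<bar>form_in_chart A \<omega> c x (axis 1 1) (axis 2 1)\<bar> \<partial>lborel)))"

text \<open>The Bochner integral is \<open>0\<close> on non-integrable functions; this matters only if \<open>\<bar>H\<bar>\<close> to the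
  power \<open>p\<close> is not integrable, which never happens for continuous compactly supported \<open>H\<close>.\<close>

definition Lp_norm :: "'a measure \<Rightarrow> real \<Rightarrow> 'a set \<Rightarrow> ('a \<Rightarrow> real) \<Rightarrow> real" where
  "Lp_norm \<mu> p X H = (LINT x:X|\<mu>. \<bar>H x\<bar> powr p) powr (1 / p)"

end

theory Submission
  imports Defs
begin

text \<open>Upper bound: take \<open>F' = F\<close>, \<open>G' = G\<close>. Lower semicontinuity is local. In a chart,
  \<open>\<bar>{F,G}\<bar>\<close> times the area density is the Jacobian of \<open>\<Phi> = (F,G)\<close>. If \<open>\<Phi>\<close> is injective on an
  open set \<open>E\<close> and \<open>\<Phi>'\<close> is \<open>\<delta>\<close>-close to \<open>\<Phi>\<close>, Brouwer's fixed point theorem shows that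
  \<open>\<Phi>'(E)\<close> contains every point whose \<open>\<delta>\<close>-ball lies in \<open>\<Phi>(E)\<close>; comparing areas,
  \<open>\<integral>\<^sub>E \<bar>{F',G'}\<bar> \<ge> \<integral>\<^sub>E \<bar>{F,G}\<bar> - o(1)\<close>. The tangent line inequality
  \<open>t\<^sup>p \<ge> p s\<^sup>p\<^sup>-\<^sup>1 t - (p - 1) s\<^sup>p\<close> with \<open>s\<close> a lower bound of \<open>\<bar>{F,G}\<bar>\<close> on \<open>E\<close> turns this into
  \<open>\<integral>\<^sub>E \<bar>{F',G'}\<bar>\<^sup>p \<ge> s\<^sup>p \<mu>(E) - o(1)\<close>. Finally, up to a null set, \<open>{F,G} \<noteq> 0\<close> is a countable disjoint
  union of open sets \<open>E\<close> of this kind on which \<open>\<bar>{F,G}\<bar>\<close> is almost constant.\<close>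

section \<open>Uniform perturbations of injective maps\<close>

text \<open>Uniform closeness says nothing about derivatives: \<open>F'\<close> and
  \<open>G'\<close> may oscillate wildly, so their bracket cannot be compared pointwise with that of
  \<open>F\<close> and \<open>G\<close>. What survives small uniform perturbations is a region that
  the image is forced to cover, and area counted with multiplicity is at least the area of that
  region; hence a lower bound but no upper one. For \<open>p > 1\<close> this controls only the
  first power. The tangent line inequality is sharp exactly where the bracket equals the point of
  tangency \<open>s\<close>, which is why the bracket must be almost constant on each piece. Pieces
  must be open for invariance of domain and disjoint for the bounds to add up; coordinate balls
  serve because their boundary spheres are null. The admissible \<delta> depends on the piece, so
  only finitely many pieces are used, enough to exceed a prescribed level below the
  integral.\<close>

lemma brouwer_perturbation:
  fixes f g :: "'a::euclidean_space \<Rightarrow> 'a"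
  assumes S: "open S" and f: "continuous_on S f" "inj_on f S" and g: "continuous_on S g"
    and close: "\<And>x. x \<in> S \<Longrightarrow> dist (g x) (f x) \<le> \<delta>" and "0 < \<delta>"
    and y: "cball y \<delta> \<subseteq> f ` S"
  shows "y \<in> g ` S"
proof -
  obtain h where h: "homeomorphism S (f ` S) f h"
    using invariance_of_domain_homeomorphism[OF S f(1) order_refl f(2)] by blast
  \<comment> \<open>a fixed point \<open>z\<close> of \<open>k\<close> satisfies \<open>g (h z) = y\<close>\<close>
  define k where "k z = z - g (h z) + y" for z
  have hS: "h z \<in> S" "f (h z) = z" if "z \<in> cball y \<delta>" for z
    using h y that by (auto simp: homeomorphism_def)
  have "continuous_on (cball y \<delta>) h"
    using continuous_on_subset[OF homeomorphism_cont2[OF h] y] .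
  moreover have "continuous_on (h ` cball y \<delta>) g"
    using hS(1) by (intro continuous_on_subset[OF g]) auto
  ultimately have "continuous_on (cball y \<delta>) k"
    unfolding k_def by (intro continuous_intros continuous_on_compose2[where f=h and g=g]) auto
  moreover have "k \<in> cball y \<delta> \<rightarrow> cball y \<delta>"
  proof
    fix z assume z: "z \<in> cball y \<delta>"
    \<comment> \<open>As \<open>f (h z) = z\<close>, the displacement \<open>k z - y\<close> is
      \<open>f (h z) - g (h z)\<close>, which closeness bounds by \<open>\<delta>\<close>.\<close>
    have "dist y (k z) = dist (g (h z)) (f (h z))"
      using hS[OF z] by (simp add: k_def dist_norm norm_minus_commute)
    then show "k z \<in> cball y \<delta>"
      using close[OF hS(1)[OF z]] by simp
  qed
  ultimately obtain z where z: "z \<in> cball y \<delta>" "k z = z"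
    using brouwer_ball[OF \<open>0 < \<delta>\<close>] by metis
  then have "g (h z) = y"
    by (simp add: k_def)
  then show ?thesis
    using hS[OF z(1)] by blast
qed

text \<open>Integrals in \<open>ennreal\<close> let the formula hold with the value infinity too:
  the sides are compared by asking which finite \<open>r\<close> they equal, and for finite values
  the version for absolutely integrable functions applies.\<close>

lemma nn_change_of_variables:
  fixes g :: "real^'n::{finite,wellorder} \<Rightarrow> real^'n::_" and f :: "real^'n::_ \<Rightarrow> real"
  assumes S: "S \<in> sets borel" and gS: "g ` S \<in> sets borel"
    and der: "\<And>x. x \<in> S \<Longrightarrow> (g has_derivative g' x) (at x within S)"
    and inj: "inj_on g S"
    and f: "f \<in> borel_measurable borel" "\<And>x. 0 \<le> f x"
    and D: "(\<lambda>x. \<bar>det (matrix (g' x))\<bar> * f (g x) * indicator S x) \<in> borel_measurable borel"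
  shows "(\<integral>\<^sup>+x\<in>g ` S. ennreal (f x) \<partial>lborel) =
    (\<integral>\<^sup>+x\<in>S. ennreal (\<bar>det (matrix (g' x))\<bar> * f (g x)) \<partial>lborel)"
proof -
  define u where "u = (\<lambda>x. f x * indicator (g ` S) x)"
  define v where "v = (\<lambda>x. \<bar>det (matrix (g' x))\<bar> * f (g x) * indicator S x)"
  have nn: "(\<integral>\<^sup>+x. ennreal (h x) \<partial>lborel) = ennreal r \<longleftrightarrow> (h has_integral r) UNIV"
    if "h \<in> borel_measurable borel" "\<And>x. 0 \<le> h x" "0 \<le> r" for h :: "real^'n::_ \<Rightarrow> real" and r
    using has_integral_iff_nn_integral_lebesgue[of h r] that
    by (simp add: nn_integral_completion measurable_completion)
  have cov: "(u has_integral r) UNIV \<longleftrightarrow> (v has_integral r) UNIV" if "0 \<le> r" for r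
  proof -
    have u: "(u has_integral r) UNIV \<longleftrightarrow> (f has_integral r) (g ` S)"
      unfolding u_def by (simp add: indicator_def of_bool_def if_distrib[of "\<lambda>x. _ * x"] has_integral_restrict_UNIV cong: if_cong)
    have v: "(v has_integral r) UNIV \<longleftrightarrow> ((\<lambda>x. \<bar>det (matrix (g' x))\<bar> * f (g x)) has_integral r) S"
      unfolding v_def by (simp add: indicator_def of_bool_def if_distrib[of "\<lambda>x. _ * x"] has_integral_restrict_UNIV cong: if_cong)
    have S': "S \<in> sets lebesgue"
      using S by simp
    have iff: "(h has_integral r) T \<longleftrightarrow> h absolutely_integrable_on T \<and> integral T h = r"
      if "\<And>x. 0 \<le> h x" for h :: "real^'n::_ \<Rightarrow> real" and T
      using that by (simp add: has_integral_iff absolutely_integrable_on_iff_nonneg)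
    \<comment> \<open>Functions into \<open>real^1\<close> bring the scalar integrand into the
      vector-valued form of the theorem.\<close>
    show ?thesis
      unfolding u v
      using has_absolute_integral_change_of_variables[OF S' der inj, of "\<lambda>x. vec (f x) :: real^1" "vec r"] f(2)
      by (simp add: iff absolutely_integrable_on_1_iff integral_on_1_eq)
  qed
  have eq: "(\<integral>\<^sup>+x. ennreal (u x) \<partial>lborel) = ennreal r \<longleftrightarrow> (\<integral>\<^sup>+x. ennreal (v x) \<partial>lborel) = ennreal r"
    if "0 \<le> r" for r
  proof -
    have "u \<in> borel_measurable borel" "v \<in> borel_measurable borel"
      using D gS f(1) unfolding u_def v_def by (auto intro!: borel_measurable_times)
    then show ?thesis
      using cov[OF that] f(2) that by (simp add: nn u_def v_def)
  qed
  have "(\<integral>\<^sup>+x. ennreal (u x) \<partial>lborel) = (\<integral>\<^sup>+x. ennreal (v x) \<partial>lborel)"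
  proof (cases "\<integral>\<^sup>+x. ennreal (u x) \<partial>lborel")
    case (real r)
    then show ?thesis using eq[of r] by simp
  next
    case top
    then show ?thesis
      by (cases "\<integral>\<^sup>+x. ennreal (v x) \<partial>lborel") (use eq in auto)
  qed
  then show ?thesis
    using f(2) by (simp add: u_def v_def ennreal_mult ennreal_indicator)
qed

text \<open>Nothing is known about injectivity of the perturbed map, so only an inequality is
  available: points covered several times count several times on the right. The image of
  \<open>S\<close> is obtained only as a Lebesgue measurable set, while \<open>lborel\<close>
  measures Borel sets; hence the Borel subset \<open>V\<close>.\<close>

lemma emeasure_le_differentiable_image:
  fixes g :: "real^'n::{finite,wellorder} \<Rightarrow> real^'n::_"
  assumes S: "S \<in> sets borel" and V: "V \<in> sets borel" "V \<subseteq> g ` S"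
    and der: "\<And>x. x \<in> S \<Longrightarrow> (g has_derivative g' x) (at x within S)"
    and D: "(\<lambda>x. \<bar>det (matrix (g' x))\<bar> * indicator S x) \<in> borel_measurable borel"
  shows "emeasure lborel V \<le> (\<integral>\<^sup>+x\<in>S. ennreal \<bar>det (matrix (g' x))\<bar> \<partial>lborel)"
proof -
  let ?D = "\<lambda>x. \<bar>det (matrix (g' x))\<bar>"
  have eq: "(\<integral>\<^sup>+x\<in>S. ennreal (?D x) \<partial>lborel) = (\<integral>\<^sup>+x. ennreal (?D x * indicator S x) \<partial>lborel)"
    by (simp add: ennreal_mult ennreal_indicator)
  show ?thesis
  proof (cases "(\<integral>\<^sup>+x\<in>S. ennreal (?D x) \<partial>lborel)")
    case (real r)
    then have "((\<lambda>x. ?D x * indicator S x) has_integral r) UNIV"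
      unfolding eq using D by (intro nn_integral_has_integral) auto
    then have int: "(?D has_integral r) S"
      by (simp add: indicator_def of_bool_def if_distrib[of "\<lambda>x. _ * x"] has_integral_restrict_UNIV cong: if_cong)
    then have gS: "g ` S \<in> lmeasurable" and "measure lebesgue (g ` S) \<le> r"
      using measurable_differentiable_image[of S g g', OF _ der]
        measure_differentiable_image[of S g g', OF _ der] S
      by (auto simp: has_integral_iff)
    moreover have "emeasure lborel V \<le> emeasure lebesgue (g ` S)"
      using emeasure_mono[OF V(2), of lebesgue] gS V(1) by (auto simp: fmeasurableD)
    ultimately show ?thesis
      using real gS by (metis emeasure_eq_measure2 ennreal_leI order_trans)
  qed simp
qed

text \<open>Since \<open>V\<close> is open, the eroded sets increase to \<open>V\<close> as the
  radius shrinks, and continuity from below applies. Closedness makes the eroded set Borel.\<close>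

lemma emeasure_erosion:
  fixes V :: "'a::euclidean_space set"
  assumes V: "open V" and fin: "emeasure lborel V < \<infinity>" and "0 < \<eta>"
  obtains r where "0 < r" "closed {y. ball y r \<subseteq> V}"
    "emeasure lborel V \<le> emeasure lborel {y. ball y r \<subseteq> V} + ennreal \<eta>"
proof -
  define W where "W n = {y. ball y (inverse (real (Suc n))) \<subseteq> V}" for n
  have closed: "closed {y. ball y r \<subseteq> V}" for r
  proof -
    have "{y. ball y r \<subseteq> V} = - (\<Union>z\<in>-V. ball z r)"
      by (auto simp: dist_commute)
    then show ?thesis
      by (simp del: Compl_UN add: closed_Compl open_UN)
  qed
  have "incseq W"
  proof (rule incseq_SucI)
    fix n
    have "inverse (real (Suc (Suc n))) \<le> inverse (real (Suc n))"
      by (simp add: field_simps)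
    then show "W n \<subseteq> W (Suc n)"
      unfolding W_def by (meson Collect_mono subset_ball subset_trans)
  qed
  moreover have "(\<Union>n. W n) = V"
  proof
    show "(\<Union>n. W n) \<subseteq> V"
    proof
      fix y assume "y \<in> (\<Union>n. W n)"
      then obtain n where "ball y (inverse (real (Suc n))) \<subseteq> V"
        by (auto simp: W_def)
      moreover have "y \<in> ball y (inverse (real (Suc n)))"
        by (simp add: centre_in_ball del: of_nat_Suc)
      ultimately show "y \<in> V"
        by blast
    qed
    show "V \<subseteq> (\<Union>n. W n)"
    proof
      fix y assume "y \<in> V"
      then obtain e where "0 < e" "ball y e \<subseteq> V"
        using V by (meson open_contains_ball)
      moreover obtain n where "inverse (real (Suc n)) < e"
        using reals_Archimedean \<open>0 < e\<close> by blast
      ultimately have "y \<in> W n"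
        using order_trans[OF subset_ball[OF less_imp_le]] unfolding W_def by blast
      then show "y \<in> (\<Union>n. W n)"
        by blast
    qed
  qed
  moreover have "range W \<subseteq> sets lborel"
    using closed by (auto simp: W_def)
  ultimately have lim: "(\<lambda>n. emeasure lborel (W n)) \<longlonglongrightarrow> emeasure lborel V"
    using Lim_emeasure_incseq[of W lborel] by simp
  \<comment> \<open>If every \<open>W n\<close> fell short by \<eta>, the limit would exceed itself
    by \<eta>, impossible for a finite measure.\<close>
  have "\<exists>n. emeasure lborel V \<le> emeasure lborel (W n) + ennreal \<eta>"
  proof (rule ccontr)
    assume "\<not> ?thesis"
    then have *: "emeasure lborel (W n) + ennreal \<eta> \<le> emeasure lborel V" for n
      by (auto simp: not_le intro: less_imp_le)
    have "(\<lambda>n. emeasure lborel (W n) + ennreal \<eta>) \<longlonglongrightarrow> emeasure lborel V + ennreal \<eta>"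
      by (intro tendsto_intros lim)
    then have "emeasure lborel V + ennreal \<eta> \<le> emeasure lborel V"
      using * by (intro LIMSEQ_le_const2) auto
    then show False
      using fin \<open>0 < \<eta>\<close> ennreal_add_left_cancel_le[of "emeasure lborel V" "ennreal \<eta>" 0]
      by (auto simp: less_top)
  qed
  then obtain n where "emeasure lborel V \<le> emeasure lborel (W n) + ennreal \<eta>" ..
  then show thesis
    using that[of "inverse (real (Suc n))"] closed unfolding W_def by (simp del: of_nat_Suc)
qed

text \<open>The erosion radius depends only on the image of \<open>f\<close> and on
  \<open>\<eta>\<close>, so one \<delta> serves all \<open>g\<close>, whatever the size of their
  derivatives. Injectivity of \<open>f\<close> makes the left integral an exact area; for
  \<open>g\<close>, multiplicity only enlarges the right one.\<close>

lemma jacobian_integral_lower_semicontinuous: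
  fixes f :: "real^'n::{finite,wellorder} \<Rightarrow> real^'n::_"
  assumes S: "open S" and inj: "inj_on f S"
    and der: "\<And>x. x \<in> S \<Longrightarrow> (f has_derivative f' x) (at x)"
    and cont: "continuous_on S (\<lambda>x. det (matrix (f' x)))"
    and fin: "(\<integral>\<^sup>+x\<in>S. ennreal \<bar>det (matrix (f' x))\<bar> \<partial>lborel) < \<infinity>" and "0 < \<eta>"
  shows "\<exists>\<delta>>0. \<forall>g g'. (\<forall>x\<in>S. (g has_derivative g' x) (at x)) \<longrightarrow>
    continuous_on S (\<lambda>x. det (matrix (g' x))) \<longrightarrow> (\<forall>x\<in>S. dist (g x) (f x) \<le> \<delta>) \<longrightarrow>
    (\<integral>\<^sup>+x\<in>S. ennreal \<bar>det (matrix (f' x))\<bar> \<partial>lborel)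
      \<le> (\<integral>\<^sup>+x\<in>S. ennreal \<bar>det (matrix (g' x))\<bar> \<partial>lborel) + ennreal \<eta>"
proof -
  have meas: "(\<lambda>x. \<bar>h x\<bar> * indicator S x) \<in> borel_measurable borel" if "continuous_on S h"
    for h :: "real^'n::_ \<Rightarrow> real"
  proof -
    have "(\<lambda>x. indicator S x *\<^sub>R \<bar>h x\<bar>) \<in> borel_measurable borel"
      using S that by (intro borel_measurable_continuous_on_indicator continuous_intros) auto
    then show ?thesis
      by (simp add: mult.commute)
  qed
  have cf: "continuous_on S f"
    by (auto intro!: continuous_at_imp_continuous_on has_derivative_continuous[OF der])
  then have V: "open (f ` S)"
    by (rule invariance_of_domain[OF _ S inj])
  have area: "emeasure lborel (f ` S) = (\<integral>\<^sup>+x\<in>S. ennreal \<bar>det (matrix (f' x))\<bar> \<partial>lborel)"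
    using nn_change_of_variables[of S f f' "\<lambda>_. 1"] S V der inj meas[OF cont]
    by (simp add: has_derivative_at_withinI)
  obtain r where r: "0 < r" "closed {y. ball y r \<subseteq> f ` S}"
    "emeasure lborel (f ` S) \<le> emeasure lborel {y. ball y r \<subseteq> f ` S} + ennreal \<eta>"
    using emeasure_erosion[OF V fin[folded area] \<open>0 < \<eta>\<close>] .
  show ?thesis
  \<comment> \<open>With half the radius, the closed ball of the fixed point argument fits into the
    open ball of the erosion.\<close>
  proof (intro exI[of _ "r / 2"] conjI allI impI)
    show "0 < r / 2" using r by simp
    fix g g'
    assume g: "\<forall>x\<in>S. (g has_derivative g' x) (at x)" "continuous_on S (\<lambda>x. det (matrix (g' x)))"
      "\<forall>x\<in>S. dist (g x) (f x) \<le> r / 2"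
    have cg: "continuous_on S g"
      using g(1) by (auto intro!: continuous_at_imp_continuous_on has_derivative_continuous)
    have "{y. ball y r \<subseteq> f ` S} \<subseteq> g ` S"
    proof clarify
      fix y assume "ball y r \<subseteq> f ` S"
      moreover have "cball y (r / 2) \<subseteq> ball y r"
        using r(1) by auto
      ultimately show "y \<in> g ` S"
        using brouwer_perturbation[OF S cf inj cg, of "r / 2" y] g(3) r(1) by auto
    qed
    then have "emeasure lborel {y. ball y r \<subseteq> f ` S} \<le> (\<integral>\<^sup>+x\<in>S. ennreal \<bar>det (matrix (g' x))\<bar> \<partial>lborel)"
      using S r(2) g(1) meas[OF g(2)]
      by (intro emeasure_le_differentiable_image) (auto intro: has_derivative_at_withinI)
    then show "(\<integral>\<^sup>+x\<in>S. ennreal \<bar>det (matrix (f' x))\<bar> \<partial>lborel)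
      \<le> (\<integral>\<^sup>+x\<in>S. ennreal \<bar>det (matrix (g' x))\<bar> \<partial>lborel) + ennreal \<eta>"
      unfolding area[symmetric] by (intro order_trans[OF r(3)] add_right_mono)
  qed
qed

text \<open>Tonelli for counting measure; it gives countable additivity of the measure glued from
  charts.\<close>

lemma suminf_swap_ennreal: "(\<Sum>i. \<Sum>n. f i n) = (\<Sum>n. \<Sum>i. f i n)" for f :: "nat \<Rightarrow> nat \<Rightarrow> ennreal"
proof -
  have "(\<Sum>i. \<Sum>n. f i n) = (\<Sum>i. \<integral>\<^sup>+n. f i n \<partial>count_space UNIV)"
    by (simp add: nn_integral_count_space_nat)
  also have "\<dots> = (\<integral>\<^sup>+n. (\<Sum>i. f i n) \<partial>count_space UNIV)"
    by (rule nn_integral_suminf[symmetric]) simp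
  finally show ?thesis
    by (simp add: nn_integral_count_space_nat)
qed

lemma powr_tangent_bound:
  fixes s t p :: real
  assumes "0 < s" "0 \<le> t" "1 \<le> p"
  shows "p * s powr (p - 1) * t \<le> t powr p + (p - 1) * s powr p"
proof (cases "t = 0")
  case False
  \<comment> \<open>Young's inequality with weights \<open>1 / p\<close> and
    \<open>1 - 1 / p\<close>; multiplied by \<open>p\<close> it becomes the tangent line of
    \<open>t powr p\<close> at \<open>s\<close>. It takes positive arguments, so
    \<open>t = 0\<close> is split off.\<close>
  have "(t powr p) powr (1 / p) * (s powr p) powr (1 - 1 / p) \<le> 1 / p * t powr p + (1 - 1 / p) * s powr p"
    using assms False Youngs_inequality_0[of "1 / p" "1 - 1 / p" "t powr p" "s powr p"] by simp
  moreover have "(t powr p) powr (1 / p) = t" "(s powr p) powr (1 - 1 / p) = s powr (p - 1)"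
    using assms False by (simp_all add: powr_powr right_diff_distrib)
  ultimately have "t * s powr (p - 1) \<le> 1 / p * t powr p + (1 - 1 / p) * s powr p"
    by simp
  then have "p * (t * s powr (p - 1)) \<le> p * (1 / p * t powr p + (1 - 1 / p) * s powr p)"
    using assms by (intro mult_left_mono) auto
  then show ?thesis
    using assms by (simp add: algebra_simps)
qed (use assms in auto)

section \<open>Charts and tangent vectors\<close>

lemma vec2_decompose: "a = (a $ 1) *\<^sub>R axis 1 1 + (a $ 2) *\<^sub>R axis 2 (1::real)" for a :: "real^2"
  by (simp add: vec_eq_iff forall_2 axis_def)

lemma det_matrix_2:
  "det (matrix L) = L (axis 1 1) $ 1 * L (axis 2 1) $ 2 - L (axis 2 1) $ 1 * L (axis 1 1) $ 2"
  for L :: "real^2 \<Rightarrow> real^2"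
  by (simp add: det_2 matrix_def)

lemma linear_functional_2:
  fixes L :: "real^2 \<Rightarrow> real"
  assumes "linear L"
  shows "L a = a $ 1 * L (axis 1 1) + a $ 2 * L (axis 2 1)"
  using arg_cong[OF vec2_decompose[of a], of L] assms by (simp add: linear_add linear_scale)

text \<open>\<open>Ck_on\<close> yields continuity of the derivative one direction at a time; two
  directions suffice for the operator norm, in which local injectivity needs it.\<close>

lemma onorm_le_axis2:
  fixes L :: "real^2 \<Rightarrow> 'b::real_normed_vector"
  assumes "linear L"
  shows "onorm L \<le> norm (L (axis 1 1)) + norm (L (axis 2 1))"
proof (rule onorm_le)
  fix v :: "real^2"
  have "L v = (v $ 1) *\<^sub>R L (axis 1 1) + (v $ 2) *\<^sub>R L (axis 2 1)"
    using arg_cong[OF vec2_decompose[of v], of L] assms by (simp add: linear_add linear_scale)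
  then have "norm (L v) \<le> \<bar>v $ 1\<bar> * norm (L (axis 1 1)) + \<bar>v $ 2\<bar> * norm (L (axis 2 1))"
    using norm_triangle_ineq[of "(v $ 1) *\<^sub>R L (axis 1 1)" "(v $ 2) *\<^sub>R L (axis 2 1)"] by simp
  also have "\<dots> \<le> norm v * norm (L (axis 1 1)) + norm v * norm (L (axis 2 1))"
    by (intro add_mono mult_right_mono component_le_norm_cart) auto
  finally show "norm (L v) \<le> (norm (L (axis 1 1)) + norm (L (axis 2 1))) * norm v"
    by (simp add: algebra_simps)
qed

lemma smooth_on_has_derivative:
  assumes "smooth_on S f" "x \<in> S"
  shows "(f has_derivative frechet_derivative f (at x)) (at x)"
proof -
  have "Ck_on (Suc 0) S f"
    using assms(1) unfolding smooth_on_def by blast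
  then show ?thesis
    using assms(2) by (simp add: frechet_derivative_works)
qed

lemma smooth_on_continuous_frechet_derivative:
  assumes "smooth_on S f"
  shows "continuous_on S (\<lambda>x. frechet_derivative f (at x) v)"
proof -
  have "Ck_on (Suc 0) S f"
    using assms unfolding smooth_on_def by blast
  then show ?thesis
    by simp
qed

lemma smooth_on_imp_continuous_on: "smooth_on S f \<Longrightarrow> continuous_on S f"
  unfolding smooth_on_def by (metis Ck_on.simps(1))

abbreviation chart_image :: "('m, 'e) chart \<Rightarrow> 'e set" where
  "chart_image c \<equiv> chart_map c ` chart_dom c"

locale symplectic_surface =
  fixes A :: "('m::{t2_space, second_countable_topology}, real^2) chart set"
    and \<omega> :: "('m, real^2) form2"
  assumes symplectic: "symplectic_manifold A \<omega>"
begin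

lemma atlas: "smooth_atlas A"
  using symplectic by (simp add: symplectic_manifold_def)

lemma open_chart_dom: "c \<in> A \<Longrightarrow> open (chart_dom c)"
  and open_chart_image: "c \<in> A \<Longrightarrow> open (chart_image c)"
  and chart_homeomorphism:
    "c \<in> A \<Longrightarrow> homeomorphism (chart_dom c) (chart_image c) (chart_map c) (chart_inv c)"
  and smooth_transition:
    "c \<in> A \<Longrightarrow> d \<in> A \<Longrightarrow> smooth_on (chart_map c ` (chart_dom c \<inter> chart_dom d)) (transition c d)"
  using atlas by (auto simp: smooth_atlas_def)

lemma obtain_chart:
  obtains c where "c \<in> A" "q \<in> chart_dom c"
  using atlas unfolding smooth_atlas_def by blast

lemma chart_inv_map: "c \<in> A \<Longrightarrow> q \<in> chart_dom c \<Longrightarrow> chart_inv c (chart_map c q) = q"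
  and chart_map_inv: "c \<in> A \<Longrightarrow> x \<in> chart_image c \<Longrightarrow> chart_map c (chart_inv c x) = x"
  and chart_inv_in_dom: "c \<in> A \<Longrightarrow> x \<in> chart_image c \<Longrightarrow> chart_inv c x \<in> chart_dom c"
  using chart_homeomorphism[of c] by (auto simp: homeomorphism_def)

lemma continuous_on_chart_map: "c \<in> A \<Longrightarrow> continuous_on (chart_dom c) (chart_map c)"
  and continuous_on_chart_inv: "c \<in> A \<Longrightarrow> continuous_on (chart_image c) (chart_inv c)"
  using chart_homeomorphism[of c] by (auto simp: homeomorphism_def)

text \<open>As a preimage under \<open>chart_inv\<close>, the image inherits openness and Borel
  measurability from the continuity of \<open>chart_inv\<close>.\<close>

lemma chart_map_image_eq:
  assumes "c \<in> A" "B \<subseteq> chart_dom c"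
  shows "chart_map c ` B = chart_inv c -` B \<inter> chart_image c"
proof
  show "chart_map c ` B \<subseteq> chart_inv c -` B \<inter> chart_image c"
    using assms chart_inv_map[OF assms(1)] by auto
  show "chart_inv c -` B \<inter> chart_image c \<subseteq> chart_map c ` B"
    using assms chart_inv_map[OF assms(1)] by auto
qed

lemma chart_inv_image_eq:
  assumes "c \<in> A" "V \<subseteq> chart_image c"
  shows "chart_inv c ` V = chart_map c -` V \<inter> chart_dom c"
proof
  show "chart_inv c ` V \<subseteq> chart_map c -` V \<inter> chart_dom c"
    using assms chart_map_inv[OF assms(1)] chart_inv_in_dom[OF assms(1)] by auto
  show "chart_map c -` V \<inter> chart_dom c \<subseteq> chart_inv c ` V"
    using assms chart_inv_map[OF assms(1)] by force
qed

lemma open_chart_map_image: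
  assumes "c \<in> A" "B \<subseteq> chart_dom c" "open B"
  shows "open (chart_map c ` B)"
  using continuous_open_preimage[OF continuous_on_chart_inv open_chart_image, of c B] assms(1,3)
  by (subst chart_map_image_eq[OF assms(1,2)]) (auto simp: Int_commute)

lemma open_chart_inv_image:
  assumes "c \<in> A" "V \<subseteq> chart_image c" "open V"
  shows "open (chart_inv c ` V)"
  using continuous_open_preimage[OF continuous_on_chart_map open_chart_dom, of c V] assms
  by (simp add: chart_inv_image_eq Int_commute)

lemma borel_chart_map_image:
  assumes "c \<in> A" "B \<subseteq> chart_dom c" "B \<in> sets borel"
  shows "chart_map c ` B \<in> sets borel"
proof -
  have "chart_inv c \<in> borel_measurable (restrict_space borel (chart_image c))"
    using assms(1) by (intro borel_measurable_continuous_on_restrict continuous_on_chart_inv)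
  from measurable_sets[OF this assms(3)] show ?thesis
    unfolding chart_map_image_eq[OF assms(1,2)] using open_chart_image[OF assms(1)]
    by (simp add: space_restrict_space sets_restrict_space_iff)
qed

section \<open>Transition derivatives and coordinates of tangent vectors\<close>

definition transition_deriv :: "('m, real^2) chart \<Rightarrow> ('m, real^2) chart \<Rightarrow> 'm \<Rightarrow> real^2 \<Rightarrow> real^2" where
  "transition_deriv c d q = frechet_derivative (transition c d) (at (chart_map c q))"

lemma has_derivative_transition:
  assumes "c \<in> A" "d \<in> A" "q \<in> chart_dom c" "q \<in> chart_dom d"
  shows "(transition c d has_derivative transition_deriv c d q) (at (chart_map c q))"
  unfolding transition_deriv_def using assms
  by (intro smooth_on_has_derivative[OF smooth_transition[OF assms(1,2)]]) auto

text \<open>The general codomain lets one chain rule serve real functions and, with \<open>h\<close>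
  a chart map, the transition maps themselves.\<close>

lemma frechet_derivative_change_chart:
  fixes h :: "'m \<Rightarrow> 'b::real_normed_vector"
  assumes cd: "c \<in> A" "d \<in> A" "q \<in> chart_dom c" "q \<in> chart_dom d"
    and h: "(h \<circ> chart_inv d has_derivative h') (at (chart_map d q))"
  shows "frechet_derivative (h \<circ> chart_inv c) (at (chart_map c q)) = h' \<circ> transition_deriv c d q"
proof -
  let ?W = "chart_map c ` (chart_dom c \<inter> chart_dom d)"
  have eq: "transition c d (chart_map c q) = chart_map d q"
    using cd by (simp add: transition_def chart_inv_map)
  have "((h \<circ> chart_inv d) \<circ> transition c d has_derivative h' \<circ> transition_deriv c d q) (at (chart_map c q))"
    using has_derivative_transition[OF cd] h by (intro diff_chain_at) (auto simp: eq)
  then have "(h \<circ> chart_inv c has_derivative h' \<circ> transition_deriv c d q) (at (chart_map c q))"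
  \<comment> \<open>The two maps agree only on the overlap of the charts, so the derivative is
    transferred on that open set.\<close>
  proof (rule has_derivative_transform_within_open[where s="?W"])
    show "open ?W"
      using cd open_chart_dom[of c] open_chart_dom[of d] by (intro open_chart_map_image open_Int) auto
    show "chart_map c q \<in> ?W"
      using cd by auto
  qed (use cd in \<open>auto simp: transition_def chart_inv_map\<close>)
  then show ?thesis
    by (rule frechet_derivative_at[symmetric])
qed

lemma transition_deriv_refl:
  assumes "c \<in> A" "q \<in> chart_dom c"
  shows "transition_deriv c c q = id"
proof -
  have "(id has_derivative id) (at (chart_map c q))"
    by (rule has_derivative_id[unfolded id_def[symmetric]])
  then have "(transition c c has_derivative id) (at (chart_map c q))"
  proof (rule has_derivative_transform_within_open[where s="chart_image c"])
    show "open (chart_image c)"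
      using assms open_chart_image by auto
  qed (use assms in \<open>auto simp: transition_def chart_inv_map\<close>)
  then show ?thesis
    unfolding transition_deriv_def by (rule frechet_derivative_at[symmetric])
qed

lemma transition_deriv_compose:
  assumes "c \<in> A" "d \<in> A" "e \<in> A" "q \<in> chart_dom c" "q \<in> chart_dom d" "q \<in> chart_dom e"
  shows "transition_deriv c e q = transition_deriv d e q \<circ> transition_deriv c d q"
  using frechet_derivative_change_chart[of c d q "chart_map e" "transition_deriv d e q"]
    has_derivative_transition[of d e q] assms
  by (simp add: transition_deriv_def transition_def[symmetric])

lemma linear_transition_deriv:
  assumes "c \<in> A" "d \<in> A" "q \<in> chart_dom c" "q \<in> chart_dom d"
  shows "linear (transition_deriv c d q)"
  using has_derivative_linear[OF has_derivative_transition[OF assms]] .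

lemma coord_tangent_alt:
  "coord_tangent A c q a = (\<lambda>d. if d \<in> A \<and> q \<in> chart_dom d then transition_deriv c d q a else 0)"
  by (auto simp: coord_tangent_def charts_at_def transition_deriv_def)

lemma tangent_space_alt:
  "v \<in> tangent_space A q \<longleftrightarrow>
     (\<forall>c\<in>A. \<forall>d\<in>A. q \<in> chart_dom c \<longrightarrow> q \<in> chart_dom d \<longrightarrow> v d = transition_deriv c d q (v c)) \<and>
     (\<forall>c. (c \<in> A \<longrightarrow> q \<notin> chart_dom c) \<longrightarrow> v c = 0)"
  unfolding tangent_space_def charts_at_def transition_deriv_def mem_Collect_eq Ball_def by blast

text \<open>The compatibility required of a tangent vector is exactly the cocycle identity of the
  transition derivatives.\<close>

lemma coord_tangent_in_tangent_space:
  assumes "c \<in> A" "q \<in> chart_dom c"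
  shows "coord_tangent A c q a \<in> tangent_space A q"
proof -
  have "transition_deriv c e q a = transition_deriv d e q (transition_deriv c d q a)"
    if "d \<in> A" "e \<in> A" "q \<in> chart_dom d" "q \<in> chart_dom e" for d e
    using transition_deriv_compose[OF assms(1) that(1,2) assms(2) that(3,4)] by simp
  note compose = this
  show ?thesis
    unfolding tangent_space_alt
  proof (intro conjI ballI impI allI)
    fix d e assume "d \<in> A" "e \<in> A" "q \<in> chart_dom d" "q \<in> chart_dom e"
    then show "coord_tangent A c q a e = transition_deriv d e q (coord_tangent A c q a d)"
      using compose[of d e] by (simp add: coord_tangent_alt)
  next
    fix d assume "d \<in> A \<longrightarrow> q \<notin> chart_dom d"
    then show "coord_tangent A c q a d = 0"
      by (auto simp: coord_tangent_alt)
  qed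
qed

lemma coord_tangent_self:
  assumes "c \<in> A" "q \<in> chart_dom c"
  shows "coord_tangent A c q a c = a"
  using assms by (simp add: coord_tangent_alt transition_deriv_refl)

lemma tangent_eq_coord_tangent:
  assumes "c \<in> A" "q \<in> chart_dom c" "v \<in> tangent_space A q"
  shows "v = coord_tangent A c q (v c)"
proof
  fix d
  show "v d = coord_tangent A c q (v c) d"
  proof (cases "d \<in> A \<and> q \<in> chart_dom d")
    case True
    then have "v d = transition_deriv c d q (v c)"
      using assms unfolding tangent_space_alt by blast
    then show ?thesis
      using True unfolding coord_tangent_alt by (simp only: simp_thms if_True)
  next
    case False
    then have "v d = 0"
      using assms unfolding tangent_space_alt by blast
    then show ?thesis
      using False unfolding coord_tangent_alt by (simp only: simp_thms if_False)
  qed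
qed

lemma coord_tangent_linear:
  assumes "c \<in> A" "q \<in> chart_dom c"
  shows "coord_tangent A c q (s *\<^sub>R a + t *\<^sub>R b) =
    (\<lambda>d. s *\<^sub>R coord_tangent A c q a d + t *\<^sub>R coord_tangent A c q b d)"
  using linear_transition_deriv[OF assms(1) _ assms(2)]
  by (auto simp: coord_tangent_alt fun_eq_iff linear_add linear_scale)

subsection \<open>The bracket in coordinates\<close>

text \<open>Signed: charts need not respect the orientation given by \<open>\<omega>\<close>, so
  absolute values appear wherever it acts as a density.\<close>

definition area_density :: "('m, real^2) chart \<Rightarrow> real^2 \<Rightarrow> real" where
  "area_density c x = form_in_chart A \<omega> c x (axis 1 1) (axis 2 1)"

lemma form_linear_left:
  assumes "u \<in> tangent_space A q" "v \<in> tangent_space A q" "w \<in> tangent_space A q"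
  shows "\<omega> q (\<lambda>c. s *\<^sub>R u c + t *\<^sub>R v c) w = s * \<omega> q u w + t * \<omega> q v w"
  and "\<omega> q u v = - \<omega> q v u"
  using symplectic assms unfolding symplectic_manifold_def two_form_def by blast+

text \<open>In dimension two a skew bilinear form is a multiple of the determinant. Linearity is
  given in the first slot only; the second is expanded by skew symmetry.\<close>

lemma form_coord_tangent:
  assumes c: "c \<in> A" "q \<in> chart_dom c"
  shows "\<omega> q (coord_tangent A c q a) (coord_tangent A c q b) =
    (a $ 1 * b $ 2 - a $ 2 * b $ 1) * area_density c (chart_map c q)"
proof -
  let ?t = "coord_tangent A c q" and ?e1 = "axis 1 1 :: real^2" and ?e2 = "axis 2 1 :: real^2"
  note T = coord_tangent_in_tangent_space[OF c]
  have left: "\<omega> q (?t a) (?t b) = a $ 1 * \<omega> q (?t ?e1) (?t b) + a $ 2 * \<omega> q (?t ?e2) (?t b)" for a b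
    using form_linear_left(1)[OF T T T, of "a $ 1" ?e1 "a $ 2" ?e2 b]
    by (simp flip: vec2_decompose coord_tangent_linear[OF c])
  have anti: "\<omega> q (?t a) (?t b) = - \<omega> q (?t b) (?t a)" for a b
    by (rule form_linear_left(2)[OF T T T])
  have self: "\<omega> q (?t a) (?t a) = 0" for a
    using anti[of a a] by simp
  have "area_density c (chart_map c q) = \<omega> q (?t ?e1) (?t ?e2)"
    using c by (simp add: area_density_def form_in_chart_def Let_def chart_inv_map)
  moreover have "\<omega> q (?t ?e1) (?t b) = b $ 2 * \<omega> q (?t ?e1) (?t ?e2)"
    using anti[of ?e1 b] left[of b ?e1] anti[of ?e2 ?e1] self[of ?e1] by simp
  moreover have "\<omega> q (?t ?e2) (?t b) = - b $ 1 * \<omega> q (?t ?e1) (?t ?e2)"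
    using anti[of ?e2 b] left[of b ?e2] self[of ?e2] by simp
  ultimately show ?thesis
    by (subst left) (simp add: algebra_simps)
qed

text \<open>With zero density, the first coordinate vector would pair to zero with every tangent
  vector, against nondegeneracy.\<close>

lemma area_density_nonzero:
  assumes c: "c \<in> A" "x \<in> chart_image c"
  shows "area_density c x \<noteq> 0"
proof
  assume 0: "area_density c x = 0"
  define q where "q = chart_inv c x"
  have q: "q \<in> chart_dom c" "chart_map c q = x"
    using c by (simp_all add: q_def chart_inv_in_dom chart_map_inv)
  let ?u = "coord_tangent A c q (axis 1 1)"
  have "\<omega> q ?u v = 0" if "v \<in> tangent_space A q" for v
    using form_coord_tangent[OF c(1) q(1), of "axis 1 1" "v c"] 0 q
      tangent_eq_coord_tangent[OF c(1) q(1) that] by simp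
  then have "?u = (\<lambda>_. 0)"
    using symplectic coord_tangent_in_tangent_space[OF c(1) q(1)]
    unfolding symplectic_manifold_def nondegenerate_form_def by blast
  then have "axis 1 1 = (0 :: real^2)"
    using coord_tangent_self[OF c(1) q(1), of "axis 1 1"] by simp
  then show False
    by (simp add: axis_eq_0_iff)
qed

lemma continuous_on_area_density: "c \<in> A \<Longrightarrow> continuous_on (chart_image c) (area_density c)"
  using symplectic unfolding symplectic_manifold_def smooth_form_def area_density_def
  by (intro smooth_on_imp_continuous_on) blast

text \<open>Pulling the form back along the transition multiplies it by a determinant; this factor
  is what makes the measures of two charts agree.\<close>

lemma area_density_change_chart:
  assumes cd: "c \<in> A" "d \<in> A" "q \<in> chart_dom c" "q \<in> chart_dom d"
  shows "area_density c (chart_map c q) = det (matrix (transition_deriv c d q)) * area_density d (chart_map d q)"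
proof -
  have ct: "coord_tangent A c q a = coord_tangent A d q (transition_deriv c d q a)" for a
    using tangent_eq_coord_tangent[OF cd(2,4) coord_tangent_in_tangent_space[OF cd(1,3)], of a] cd
    by (simp add: coord_tangent_alt)
  have "area_density c (chart_map c q) = \<omega> q (coord_tangent A c q (axis 1 1)) (coord_tangent A c q (axis 2 1))"
    using cd by (simp add: area_density_def form_in_chart_def Let_def chart_inv_map)
  also have "\<dots> = det (matrix (transition_deriv c d q)) * area_density d (chart_map d q)"
    unfolding ct form_coord_tangent[OF cd(2,4)] det_matrix_2 by (simp add: algebra_simps)
  finally show ?thesis .
qed

abbreviation (input) chart_deriv :: "('m, real^2) chart \<Rightarrow> ('m \<Rightarrow> real) \<Rightarrow> real^2 \<Rightarrow> real^2 \<Rightarrow> real" where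
  "chart_deriv c H x \<equiv> frechet_derivative (H \<circ> chart_inv c) (at x)"

lemma has_derivative_chart:
  assumes "smooth_fun A H" "c \<in> A" "x \<in> chart_image c"
  shows "(H \<circ> chart_inv c has_derivative chart_deriv c H x) (at x)"
  using assms unfolding smooth_fun_def by (blast intro: smooth_on_has_derivative)

lemma continuous_on_chart_deriv:
  assumes "smooth_fun A H" "c \<in> A"
  shows "continuous_on (chart_image c) (\<lambda>x. chart_deriv c H x v)"
  using assms unfolding smooth_fun_def by (blast intro: smooth_on_continuous_frechet_derivative)

text \<open>The chart inside \<open>differential\<close> comes from a choice operator; the chain
  rule carries the value from that chart to \<open>c\<close>.\<close>

lemma differential_in_chart:
  assumes H: "smooth_fun A H" and c: "c \<in> A" "q \<in> chart_dom c" and v: "v \<in> tangent_space A q"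
  shows "differential A H q v = chart_deriv c H (chart_map c q) (v c)"
proof -
  define d where "d = (SOME d. d \<in> charts_at A q)"
  have "c \<in> charts_at A q"
    using c by (simp add: charts_at_def)
  then have "d \<in> charts_at A q"
    unfolding d_def by (rule someI)
  then have d: "d \<in> A" "q \<in> chart_dom d"
    by (auto simp: charts_at_def)
  have "differential A H q v = chart_deriv d H (chart_map d q) (v d)"
    by (simp add: differential_def d_def Let_def)
  also have "v d = transition_deriv c d q (v c)"
    using v c d unfolding tangent_space_alt by blast
  also have "chart_deriv d H (chart_map d q) (transition_deriv c d q (v c)) = chart_deriv c H (chart_map c q) (v c)"
    unfolding frechet_derivative_change_chart[OF c(1) d(1) c(2) d(2) has_derivative_chart[OF H d(1) imageI[OF d(2)]]]
    by (rule comp_apply[symmetric])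
  finally show ?thesis .
qed

text \<open>With \<open>w\<close> the area density and \<open>H1\<close>, \<open>H2\<close> the
  partial derivatives, the defining equation reads
  \<open>w (X1 v2 - X2 v1) = - (H1 v1 + H2 v2)\<close>; comparing coefficients,
  \<open>X1 = - H2 / w\<close> and \<open>X2 = H1 / w\<close>. This also gives the uniqueness that
  the description operator needs.\<close>

lemma hamiltonian_vf_in_chart:
  assumes H: "smooth_fun A H" and c: "c \<in> A" "q \<in> chart_dom c"
  defines "x \<equiv> chart_map c q"
  shows "hamiltonian_vf A \<omega> H q = coord_tangent A c q
    ((1 / area_density c x) *\<^sub>R (- chart_deriv c H x (axis 2 1) *\<^sub>R axis 1 1 + chart_deriv c H x (axis 1 1) *\<^sub>R axis 2 1))"
    (is "_ = coord_tangent A c q ?X")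
proof -
  have x: "x \<in> chart_image c"
    using c by (simp add: x_def)
  note T = coord_tangent_in_tangent_space[OF c]
  note w = area_density_nonzero[OF c(1) x]
  have lin: "linear (chart_deriv c H x)"
    using has_derivative_linear[OF has_derivative_chart[OF H c(1) x]] .
  have dH: "differential A H q v = v c $ 1 * chart_deriv c H x (axis 1 1) + v c $ 2 * chart_deriv c H x (axis 2 1)"
    if "v \<in> tangent_space A q" for v
    unfolding differential_in_chart[OF H c that] x_def[symmetric] by (rule linear_functional_2[OF lin])
  have form: "\<omega> q u v = (u c $ 1 * v c $ 2 - u c $ 2 * v c $ 1) * area_density c x"
    if "u \<in> tangent_space A q" "v \<in> tangent_space A q" for u v
    using form_coord_tangent[OF c, of "u c" "v c"]
    unfolding x_def tangent_eq_coord_tangent[OF c that(1), symmetric]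
      tangent_eq_coord_tangent[OF c that(2), symmetric] .
  have self: "coord_tangent A c q a c = a" for a
    by (rule coord_tangent_self[OF c])
  show ?thesis
    unfolding hamiltonian_vf_def
  proof (rule the_equality)
    show "coord_tangent A c q ?X \<in> tangent_space A q \<and>
      (\<forall>v\<in>tangent_space A q. \<omega> q (coord_tangent A c q ?X) v = - differential A H q v)"
      using w by (auto simp: T form dH self field_simps axis_def)
  next
    fix X assume X: "X \<in> tangent_space A q \<and> (\<forall>v\<in>tangent_space A q. \<omega> q X v = - differential A H q v)"
    then have "\<omega> q X (coord_tangent A c q (axis 1 1)) = - differential A H q (coord_tangent A c q (axis 1 1))"
      "\<omega> q X (coord_tangent A c q (axis 2 1)) = - differential A H q (coord_tangent A c q (axis 2 1))"
      using T by auto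
    then have "X c = ?X"
      using X w by (simp add: form dH T self vec_eq_iff forall_2 axis_def field_simps)
    then show "X = coord_tangent A c q ?X"
      using tangent_eq_coord_tangent[OF c, of X] X by simp
  qed
qed

definition jacobian :: "('m, real^2) chart \<Rightarrow> ('m \<Rightarrow> real) \<Rightarrow> ('m \<Rightarrow> real) \<Rightarrow> real^2 \<Rightarrow> real" where
  "jacobian c F G x = chart_deriv c F x (axis 1 1) * chart_deriv c G x (axis 2 1)
     - chart_deriv c F x (axis 2 1) * chart_deriv c G x (axis 1 1)"

text \<open>The determinant of the two Hamiltonian vectors is the Jacobian over the squared density,
  and \<open>\<omega>\<close> gives one density back. The minus sign comes from the definition of
  the bracket and disappears in all norms.\<close>

lemma poisson_bracket_in_chart:
  assumes "smooth_fun A F" "smooth_fun A G" and c: "c \<in> A" "q \<in> chart_dom c"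
  shows "poisson_bracket A \<omega> F G q * area_density c (chart_map c q) = - jacobian c F G (chart_map c q)"
  using area_density_nonzero[OF c(1), of "chart_map c q"] c(2) assms
  by (simp add: poisson_bracket_def hamiltonian_vf_in_chart[OF _ c] form_coord_tangent[OF c]
      jacobian_def axis_def field_simps)

lemma abs_poisson_bracket_in_chart:
  assumes "smooth_fun A F" "smooth_fun A G" and c: "c \<in> A" "x \<in> chart_image c"
  shows "\<bar>area_density c x\<bar> * \<bar>poisson_bracket A \<omega> F G (chart_inv c x)\<bar> = \<bar>jacobian c F G x\<bar>"
  using poisson_bracket_in_chart[OF assms(1,2) c(1) chart_inv_in_dom[OF c]] chart_map_inv[OF c]
  by (metis abs_minus_cancel abs_mult mult.commute)

lemma continuous_on_jacobian:
  assumes "smooth_fun A F" "smooth_fun A G" "c \<in> A"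
  shows "continuous_on (chart_image c) (jacobian c F G)"
  unfolding jacobian_def using assms by (intro continuous_intros continuous_on_chart_deriv)

text \<open>Continuity is local, and in a chart the function is a quotient of continuous functions
  with nonvanishing denominator.\<close>

lemma continuous_abs_poisson_bracket:
  assumes "smooth_fun A F" "smooth_fun A G"
  shows "continuous_on UNIV (\<lambda>q. \<bar>poisson_bracket A \<omega> F G q\<bar>)"
proof -
  have "continuous (at q) (\<lambda>q. \<bar>poisson_bracket A \<omega> F G q\<bar>)" for q
  proof -
    obtain c where c: "c \<in> A" "q \<in> chart_dom c"
      by (rule obtain_chart)
    have "continuous_on (chart_dom c) (\<lambda>q. \<bar>jacobian c F G (chart_map c q)\<bar> / \<bar>area_density c (chart_map c q)\<bar>)"
      using c area_density_nonzero[OF c(1)]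
      by (intro continuous_intros continuous_on_compose2[OF continuous_on_jacobian[OF assms c(1)]]
          continuous_on_compose2[OF continuous_on_area_density[OF c(1)]] continuous_on_chart_map) auto
    moreover have "\<bar>jacobian c F G (chart_map c q)\<bar> / \<bar>area_density c (chart_map c q)\<bar> = \<bar>poisson_bracket A \<omega> F G q\<bar>"
      if "q \<in> chart_dom c" for q
      using abs_poisson_bracket_in_chart[OF assms c(1), of "chart_map c q"]
        area_density_nonzero[OF c(1), of "chart_map c q"] that c(1) by (auto simp: chart_inv_map field_simps)
    ultimately have "continuous_on (chart_dom c) (\<lambda>q. \<bar>poisson_bracket A \<omega> F G q\<bar>)"
      by (rule continuous_on_eq)
    then show ?thesis
      using c open_chart_dom continuous_on_eq_continuous_at by blast
  qed
  then show ?thesis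
    by (simp add: continuous_at_imp_continuous_on)
qed

section \<open>The map into the plane with components F and G\<close>

definition joint :: "('m \<Rightarrow> real) \<Rightarrow> ('m \<Rightarrow> real) \<Rightarrow> 'm \<Rightarrow> real^2" where
  "joint F G q = F q *\<^sub>R axis 1 1 + G q *\<^sub>R axis 2 1"

definition joint_deriv :: "('m, real^2) chart \<Rightarrow> ('m \<Rightarrow> real) \<Rightarrow> ('m \<Rightarrow> real) \<Rightarrow> real^2 \<Rightarrow> real^2 \<Rightarrow> real^2" where
  "joint_deriv c F G x h = chart_deriv c F x h *\<^sub>R axis 1 1 + chart_deriv c G x h *\<^sub>R axis 2 1"

lemma has_derivative_joint:
  assumes "smooth_fun A F" "smooth_fun A G" "c \<in> A" "x \<in> chart_image c"
  shows "(joint F G \<circ> chart_inv c has_derivative joint_deriv c F G x) (at x)"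
proof -
  have "((\<lambda>x. (F \<circ> chart_inv c) x *\<^sub>R axis 1 1 + (G \<circ> chart_inv c) x *\<^sub>R (axis 2 1 :: real^2)) has_derivative
    (\<lambda>h. chart_deriv c F x h *\<^sub>R axis 1 1 + chart_deriv c G x h *\<^sub>R axis 2 1)) (at x)"
    using assms by (intro derivative_intros has_derivative_chart)
  then show ?thesis
    by (simp add: joint_def[abs_def] joint_deriv_def[abs_def] comp_def)
qed

lemma det_joint_deriv: "det (matrix (joint_deriv c F G x)) = jacobian c F G x"
  by (simp add: det_matrix_2 joint_deriv_def jacobian_def axis_def)

lemma dist_joint: "dist (joint F' G' q) (joint F G q) \<le> \<bar>F' q - F q\<bar> + \<bar>G' q - G q\<bar>"
proof -
  have "joint F' G' q - joint F G q = (F' q - F q) *\<^sub>R axis 1 1 + (G' q - G q) *\<^sub>R axis 2 1"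
    by (simp add: joint_def algebra_simps)
  then show ?thesis
    using norm_triangle_ineq[of "(F' q - F q) *\<^sub>R axis 1 1 :: real^2" "(G' q - G q) *\<^sub>R axis 2 1"]
    by (simp add: dist_norm norm_axis_1)
qed

section \<open>The area measure\<close>

lemma borel_chart_sets: "c \<in> A \<Longrightarrow> chart_dom c \<in> sets borel" "c \<in> A \<Longrightarrow> chart_image c \<in> sets borel"
  using open_chart_dom open_chart_image by auto

lemma measurable_chart_inv:
  "c \<in> A \<Longrightarrow> chart_inv c \<in> measurable (restrict_space lborel (chart_image c)) borel"
  using borel_measurable_continuous_on_restrict[OF continuous_on_chart_inv, of c]
  by (simp cong: measurable_cong_sets add: sets_restrict_space)

lemma measurable_area_density:
  "c \<in> A \<Longrightarrow> area_density c \<in> measurable (restrict_space lborel (chart_image c)) borel"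
  using borel_measurable_continuous_on_restrict[OF continuous_on_area_density, of c]
  by (simp cong: measurable_cong_sets add: sets_restrict_space)

text \<open>Restriction to the chart image comes before the push-forward because
  \<open>chart_inv\<close> and the density are uncontrolled outside it. The result is a Borel
  measure on the whole surface carried by the chart domain.\<close>

definition chart_measure :: "('m, real^2) chart \<Rightarrow> 'm measure" where
  "chart_measure c = distr (density (restrict_space lborel (chart_image c)) (\<lambda>x. ennreal \<bar>area_density c x\<bar>))
     borel (chart_inv c)"

lemma sets_chart_measure [simp, measurable_cong]: "sets (chart_measure c) = sets borel"
  by (simp add: chart_measure_def)

lemma nn_integral_chart_measure:
  assumes c: "c \<in> A" and h: "h \<in> borel_measurable borel"
  shows "(\<integral>\<^sup>+q. h q \<partial>chart_measure c) =
    (\<integral>\<^sup>+x\<in>chart_image c. ennreal \<bar>area_density c x\<bar> * h (chart_inv c x) \<partial>lborel)"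
proof -
  let ?R = "restrict_space lborel (chart_image c)"
  note [measurable] = measurable_chart_inv[OF c] measurable_area_density[OF c] h
  have "(\<integral>\<^sup>+q. h q \<partial>chart_measure c) =
    (\<integral>\<^sup>+x. h (chart_inv c x) \<partial>density ?R (\<lambda>x. ennreal \<bar>area_density c x\<bar>))"
    unfolding chart_measure_def by (rule nn_integral_distr) measurable
  also have "\<dots> = (\<integral>\<^sup>+x. ennreal \<bar>area_density c x\<bar> * h (chart_inv c x) \<partial>?R)"
    by (rule nn_integral_density) measurable
  also have "\<dots> = (\<integral>\<^sup>+x\<in>chart_image c. ennreal \<bar>area_density c x\<bar> * h (chart_inv c x) \<partial>lborel)"
    using borel_chart_sets[OF c] by (intro nn_integral_restrict_space) simp
  finally show ?thesis .
qed

lemma emeasure_chart_measure: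
  assumes c: "c \<in> A" and B: "B \<in> sets borel" "B \<subseteq> chart_dom c"
  shows "emeasure (chart_measure c) B = (\<integral>\<^sup>+x\<in>chart_map c ` B. ennreal \<bar>area_density c x\<bar> \<partial>lborel)"
proof -
  have "emeasure (chart_measure c) B = (\<integral>\<^sup>+q. indicator B q \<partial>chart_measure c)"
    using B by simp
  also have "\<dots> = (\<integral>\<^sup>+x\<in>chart_image c. ennreal \<bar>area_density c x\<bar> * indicator B (chart_inv c x) \<partial>lborel)"
    using B by (intro nn_integral_chart_measure c) simp
  also have "\<dots> = (\<integral>\<^sup>+x\<in>chart_map c ` B. ennreal \<bar>area_density c x\<bar> \<partial>lborel)"
    unfolding chart_map_image_eq[OF c B(2)] by (intro nn_integral_cong) (simp add: indicator_def)
  finally show ?thesis .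
qed

lemma borel_measurable_area_density_indicator:
  assumes "c \<in> A" "T \<in> sets borel" "T \<subseteq> chart_image c"
  shows "(\<lambda>x. \<bar>area_density c x\<bar> * indicator T x) \<in> borel_measurable borel"
proof -
  have "(\<lambda>x. indicator (chart_image c) x *\<^sub>R \<bar>area_density c x\<bar>) \<in> borel_measurable borel"
    using assms(1) borel_chart_sets
    by (intro borel_measurable_continuous_on_indicator continuous_intros continuous_on_area_density) auto
  then have "(\<lambda>x. indicator (chart_image c) x *\<^sub>R \<bar>area_density c x\<bar> * indicator T x) \<in> borel_measurable borel"
    using assms(2) by (intro borel_measurable_times) auto
  moreover have "(\<lambda>x. indicator (chart_image c) x *\<^sub>R \<bar>area_density c x\<bar> * indicator T x) =
    (\<lambda>x. \<bar>area_density c x\<bar> * indicator T x)"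
    using assms(3) by (auto simp: indicator_def fun_eq_iff)
  ultimately show ?thesis
    by simp
qed

text \<open>The transition map carries one coordinate image of \<open>B\<close> to the other, and
  its Jacobian is the quotient of the densities up to sign, so this is a change of
  variables.\<close>

lemma chart_measure_change_chart:
  assumes c: "c \<in> A" and d: "d \<in> A" and B: "B \<in> sets borel" "B \<subseteq> chart_dom c" "B \<subseteq> chart_dom d"
  shows "emeasure (chart_measure c) B = emeasure (chart_measure d) B"
proof -
  define S where "S = chart_map c ` B"
  define g where "g = transition c d"
  define g' where "g' x = transition_deriv c d (chart_inv c x)" for x
  \<comment> \<open>The density is controlled on the chart image only; the cutoff makes
    \<open>f\<close> Borel on the whole plane.\<close>
  define f where "f x = \<bar>area_density d x\<bar> * indicator (chart_map d ` B) x" for x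
  have g_eq: "g (chart_map c q) = chart_map d q" if "q \<in> B" for q
    using that B c d by (auto simp: g_def transition_def chart_inv_map)
  have gS: "g ` S = chart_map d ` B"
    unfolding S_def image_image using g_eq by (intro image_cong) auto
  have borel: "chart_map c ` B \<in> sets borel" "chart_map d ` B \<in> sets borel"
    using borel_chart_map_image c d B by blast+
  have jac: "\<bar>det (matrix (g' x))\<bar> * f (g x) = \<bar>area_density c x\<bar>" if "x \<in> S" for x
  proof -
    obtain q where q: "q \<in> B" "x = chart_map c q"
      using \<open>x \<in> S\<close> by (auto simp: S_def)
    have "q \<in> chart_dom c" "q \<in> chart_dom d"
      using q B by auto
    then show ?thesis
      using area_density_change_chart[OF c d, of q] q g_eq[of q] c
      by (simp add: g'_def f_def chart_inv_map abs_mult)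
  qed
  have "(\<integral>\<^sup>+x\<in>g ` S. ennreal (f x) \<partial>lborel) = (\<integral>\<^sup>+x\<in>S. ennreal (\<bar>det (matrix (g' x))\<bar> * f (g x)) \<partial>lborel)"
  proof (rule nn_change_of_variables)
    show "S \<in> sets borel" "g ` S \<in> sets borel"
      using borel by (simp_all only: gS, simp only: S_def)
    show "(g has_derivative g' x) (at x within S)" if "x \<in> S" for x
    proof -
      obtain q where q: "q \<in> B" "x = chart_map c q"
        using \<open>x \<in> S\<close> by (auto simp: S_def)
      then have "q \<in> chart_dom c" "q \<in> chart_dom d"
        using B by auto
      then show ?thesis
        using has_derivative_transition[OF c d] c q(2)
        by (simp add: g_def g'_def chart_inv_map has_derivative_at_withinI)
    qed
    show "inj_on g S"
    proof (rule inj_onI)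
      fix x y assume "x \<in> S" "y \<in> S" "g x = g y"
      then obtain q r where "q \<in> B" "x = chart_map c q" "r \<in> B" "y = chart_map c r"
        by (auto simp: S_def)
      moreover have "q = r"
        using \<open>g x = g y\<close> calculation g_eq chart_inv_map[OF d] B(3) by (metis subsetD)
      ultimately show "x = y"
        by simp
    qed
    show "f \<in> borel_measurable borel"
      unfolding f_def using d borel B by (intro borel_measurable_area_density_indicator) auto
    show "0 \<le> f x" for x
      by (simp add: f_def)
    have "(\<lambda>x. \<bar>det (matrix (g' x))\<bar> * f (g x) * indicator S x) = (\<lambda>x. \<bar>area_density c x\<bar> * indicator S x)"
      using jac by (auto simp: indicator_def fun_eq_iff)
    then show "(\<lambda>x. \<bar>det (matrix (g' x))\<bar> * f (g x) * indicator S x) \<in> borel_measurable borel"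
      using borel_measurable_area_density_indicator[OF c, of S] borel B by (auto simp: S_def)
  qed
  also have "\<dots> = (\<integral>\<^sup>+x\<in>S. ennreal \<bar>area_density c x\<bar> \<partial>lborel)"
    by (intro nn_integral_cong) (simp add: indicator_def jac)
  also have "\<dots> = emeasure (chart_measure c) B"
    using emeasure_chart_measure[OF c] B by (simp add: S_def)
  finally have "emeasure (chart_measure c) B = (\<integral>\<^sup>+x\<in>chart_map d ` B. ennreal (f x) \<partial>lborel)"
    by (simp add: gS)
  also have "\<dots> = (\<integral>\<^sup>+x\<in>chart_map d ` B. ennreal \<bar>area_density d x\<bar> \<partial>lborel)"
    by (intro nn_integral_cong) (simp add: indicator_def f_def)
  also have "\<dots> = emeasure (chart_measure d) B"
    using emeasure_chart_measure[OF d] B by simp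
  finally show ?thesis .
qed

section \<open>Existence and uniqueness of the area measure\<close>

lemma obtain_borel_partition:
  obtains C :: "nat \<Rightarrow> ('m, real^2) chart" and E :: "nat \<Rightarrow> 'm set"
  where "\<forall>n. C n \<in> A \<and> E n \<in> sets borel \<and> E n \<subseteq> chart_dom (C n)" "disjoint_family E" "(\<Union>n. E n) = UNIV"
proof -
  \<comment> \<open>Second countability enters here: countably many chart domains already
    cover.\<close>
  obtain \<F> where \<F>: "\<F> \<subseteq> chart_dom ` A" "countable \<F>" "\<Union>\<F> = \<Union>(chart_dom ` A)"
    using Lindelof[of "chart_dom ` A"] open_chart_dom by (metis imageE)
  have UN: "\<Union>\<F> = UNIV"
    using \<F>(3) atlas by (simp add: smooth_atlas_def)
  then have "\<F> \<noteq> {}"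
    by auto
  define U where "U = from_nat_into \<F>"
  have range: "range U = \<F>"
    unfolding U_def using \<F>(2) \<open>\<F> \<noteq> {}\<close> by (rule range_from_nat_into[rotated])
  have "\<exists>c. c \<in> A \<and> chart_dom c = U n" for n
    using range \<F>(1) by (metis imageE rangeI subsetD)
  then obtain C where C: "\<And>n. C n \<in> A" "\<And>n. chart_dom (C n) = U n"
    by metis
  have borel: "range U \<subseteq> sets borel"
    using C open_chart_dom by (metis borel_open image_subsetI)
  show thesis
  proof (rule that[of C "disjointed U"])
    show "\<forall>n. C n \<in> A \<and> disjointed U n \<in> sets borel \<and> disjointed U n \<subseteq> chart_dom (C n)"
      using sets.range_disjointed_sets[OF borel] disjointed_subset[of U] C by auto
    show "(\<Union>n. disjointed U n) = UNIV"
      using UN range by (simp add: UN_disjointed_eq)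
  qed (rule disjoint_family_disjointed)
qed

definition is_area_measure :: "'m measure \<Rightarrow> bool" where
  "is_area_measure \<mu> \<longleftrightarrow> sets \<mu> = sets borel \<and>
     (\<forall>c\<in>A. \<forall>B\<in>sets borel. B \<subseteq> chart_dom c \<longrightarrow> emeasure \<mu> B = emeasure (chart_measure c) B)"

lemma area_measure_alt: "area_measure A \<omega> = (THE \<mu>. is_area_measure \<mu>)"
proof -
  have "(\<forall>c\<in>A. \<forall>B\<in>sets borel. B \<subseteq> chart_dom c \<longrightarrow> emeasure \<mu> B = emeasure (chart_measure c) B) \<longleftrightarrow>
    (\<forall>c\<in>A. \<forall>B\<in>sets borel. B \<subseteq> chart_dom c \<longrightarrow>
      emeasure \<mu> B = (\<integral>\<^sup>+x\<in>chart_map c ` B. ennreal \<bar>area_density c x\<bar> \<partial>lborel))" for \<mu> :: "'m measure"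
    using emeasure_chart_measure by (intro ball_cong refl) (metis (lifting))
  then show ?thesis
    unfolding area_measure_def is_area_measure_def area_density_def by simp
qed

text \<open>\<open>area_measure\<close> is a definite description, so nothing can be read off before
  existence and uniqueness. A Borel partition subordinate to the charts settles both: it shows how
  to assemble the measure and that its values are forced.\<close>

lemma ex1_area_measure: "\<exists>!\<mu>. is_area_measure \<mu>"
proof -
  obtain C E where "\<forall>n::nat. C n \<in> A \<and> E n \<in> sets borel \<and> E n \<subseteq> chart_dom (C n)"
    "disjoint_family E" "(\<Union>n. E n) = UNIV"
    by (rule obtain_borel_partition)
  then have CE: "\<And>n. C n \<in> A" "\<And>n. E n \<in> sets borel" "\<And>n. E n \<subseteq> chart_dom (C n)"
    "disjoint_family E" "(\<Union>n. E n) = UNIV"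
    by blast+
  have split: "(\<Sum>n. emeasure M (B \<inter> E n)) = emeasure M B"
    if "sets M = sets borel" "B \<in> sets borel" for M :: "'m measure" and B
  proof -
    have "(\<Sum>n. emeasure M (B \<inter> E n)) = emeasure M (\<Union>n. B \<inter> E n)"
      using CE(2,4) that by (intro suminf_emeasure) (auto simp: disjoint_family_on_def)
    moreover have "(\<Union>n. B \<inter> E n) = B"
      using CE(5) by auto
    ultimately show ?thesis by simp
  qed
  define m where "m B = (\<Sum>n. emeasure (chart_measure (C n)) (B \<inter> E n))" for B
  define \<mu> where "\<mu> = measure_of UNIV (sets borel) m"
  have sets: "sets \<mu> = sets borel"
    unfolding \<mu>_def by (metis sets.sets_measure_of_eq space_borel)
  have "countably_additive (sets \<mu>) m"
  proof (rule countably_additiveI)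
    fix B :: "nat \<Rightarrow> 'm set"
    assume B: "range B \<subseteq> sets \<mu>" "disjoint_family B"
    have "(\<Sum>i. m (B i)) = (\<Sum>n. \<Sum>i. emeasure (chart_measure (C n)) (B i \<inter> E n))"
      unfolding m_def by (rule suminf_swap_ennreal)
    also have "\<dots> = (\<Sum>n. emeasure (chart_measure (C n)) (\<Union>i. B i \<inter> E n))"
      using B CE(2) sets by (intro suminf_cong suminf_emeasure) (auto simp: disjoint_family_on_def)
    also have "\<dots> = m (\<Union>i. B i)"
      unfolding m_def by (intro suminf_cong arg_cong2[where f=emeasure]) auto
    finally show "(\<Sum>i. m (B i)) = m (\<Union>i. B i)" .
  qed
  moreover have "positive (sets \<mu>) m"
    by (simp add: positive_def m_def)
  ultimately have m: "emeasure \<mu> B = m B" if "B \<in> sets borel" for B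
    using that sets by (intro emeasure_measure_of[OF \<mu>_def]) auto
  have area: "is_area_measure \<mu>"
    unfolding is_area_measure_def
  proof (intro conjI ballI impI)
    fix c B assume c: "c \<in> A" and B: "B \<in> sets borel" "B \<subseteq> chart_dom c"
    have "emeasure \<mu> B = (\<Sum>n. emeasure (chart_measure (C n)) (B \<inter> E n))"
      using m[OF B(1)] by (simp add: m_def)
    \<comment> \<open>Each piece lies in the domains of both \<open>c\<close> and
      \<open>C n\<close>, where the chart measures coincide; a single measure is left, and the
      pieces sum to \<open>B\<close>.\<close>
    also have "\<dots> = (\<Sum>n. emeasure (chart_measure c) (B \<inter> E n))"
      by (intro suminf_cong chart_measure_change_chart[OF CE(1) c] sets.Int[OF B(1) CE(2)]
          le_infI1[OF B(2)] le_infI2[OF CE(3)])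
    finally show "emeasure \<mu> B = emeasure (chart_measure c) B"
      using split[OF sets_chart_measure B(1)] by simp
  qed (rule sets)
  show ?thesis
  proof (intro ex1I[where P=is_area_measure, OF area])
    fix \<nu> assume \<nu>: "is_area_measure \<nu>"
    show "\<nu> = \<mu>"
    proof (rule measure_eqI)
      show "sets \<nu> = sets \<mu>"
        using \<nu> sets by (simp add: is_area_measure_def)
      fix B assume "B \<in> sets \<nu>"
      then have B: "B \<in> sets borel"
        using \<nu> by (simp add: is_area_measure_def)
      have "emeasure \<nu> B = (\<Sum>n. emeasure \<nu> (B \<inter> E n))"
        using split[of \<nu> B] B \<nu> by (simp add: is_area_measure_def)
      also have "\<dots> = m B"
        unfolding m_def
      proof (rule suminf_cong)
        fix n
        show "emeasure \<nu> (B \<inter> E n) = emeasure (chart_measure (C n)) (B \<inter> E n)"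
          using \<nu> CE(1)[of n] CE(2)[of n] CE(3)[of n] B unfolding is_area_measure_def
          by (meson inf.coboundedI2 sets.Int)
      qed
      finally show "emeasure \<nu> B = emeasure \<mu> B"
        using m[OF B] by simp
    qed
  qed
qed

abbreviation area :: "'m measure" where
  "area \<equiv> area_measure A \<omega>"

lemma is_area_measure_area: "is_area_measure area"
  unfolding area_measure_alt by (rule theI'[OF ex1_area_measure])

lemma sets_area [simp, measurable_cong]: "sets area = sets borel"
  using is_area_measure_area by (simp add: is_area_measure_def)

lemma space_area [simp]: "space area = UNIV"
  using sets_eq_imp_space_eq[OF sets_area] by simp

lemma emeasure_area:
  "c \<in> A \<Longrightarrow> B \<in> sets borel \<Longrightarrow> B \<subseteq> chart_dom c \<Longrightarrow> emeasure area B = emeasure (chart_measure c) B"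
  using is_area_measure_area by (simp add: is_area_measure_def)

lemma nn_integral_area:
  assumes c: "c \<in> A" and B: "B \<in> sets borel" "B \<subseteq> chart_dom c" and h: "h \<in> borel_measurable borel"
  shows "(\<integral>\<^sup>+q\<in>B. h q \<partial>area) =
    (\<integral>\<^sup>+x\<in>chart_map c ` B. ennreal \<bar>area_density c x\<bar> * h (chart_inv c x) \<partial>lborel)"
proof -
  \<comment> \<open>The measures agree only inside the chart domain; weighting both by the indicator
    of \<open>B\<close> gives equality on all Borel sets, hence of integrals.\<close>
  have eq: "density area (indicator B) = density (chart_measure c) (indicator B)"
  proof (rule measure_eqI)
    fix T assume "T \<in> sets (density area (indicator B))"
    then have "T \<in> sets borel" by simp
    then show "emeasure (density area (indicator B)) T = emeasure (density (chart_measure c) (indicator B)) T"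
      using B emeasure_area[OF c, of "B \<inter> T"] by (subst (1 2) emeasure_density) (auto simp flip: indicator_inter_arith)
  qed simp
  have "(\<integral>\<^sup>+q\<in>B. h q \<partial>area) = (\<integral>\<^sup>+q. h q \<partial>density area (indicator B))"
    using B h by (subst nn_integral_density) (auto simp: mult.commute)
  also have "\<dots> = (\<integral>\<^sup>+q\<in>B. h q \<partial>chart_measure c)"
    unfolding eq using B h by (subst nn_integral_density) (auto simp: mult.commute)
  also have "\<dots> = (\<integral>\<^sup>+x\<in>chart_image c. ennreal \<bar>area_density c x\<bar> * (h (chart_inv c x) * indicator B (chart_inv c x)) \<partial>lborel)"
    using B h by (intro nn_integral_chart_measure c) auto
  also have "\<dots> = (\<integral>\<^sup>+x\<in>chart_map c ` B. ennreal \<bar>area_density c x\<bar> * h (chart_inv c x) \<partial>lborel)"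
    unfolding chart_map_image_eq[OF c B(2)] by (intro nn_integral_cong) (simp add: indicator_def)
  finally show ?thesis .
qed

text \<open>The form disappears on the right, which reduces the local problem to maps between planar
  regions.\<close>

lemma nn_integral_poisson_bracket:
  assumes FG: "smooth_fun A F" "smooth_fun A G" and c: "c \<in> A" and B: "B \<in> sets borel" "B \<subseteq> chart_dom c"
  shows "(\<integral>\<^sup>+q\<in>B. ennreal \<bar>poisson_bracket A \<omega> F G q\<bar> \<partial>area) =
    (\<integral>\<^sup>+x\<in>chart_map c ` B. ennreal \<bar>jacobian c F G x\<bar> \<partial>lborel)"
proof -
  have "(\<lambda>q. ennreal \<bar>poisson_bracket A \<omega> F G q\<bar>) \<in> borel_measurable borel"
    using borel_measurable_continuous_onI[OF continuous_abs_poisson_bracket[OF FG]] by measurable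
  from nn_integral_area[OF c B this] show ?thesis
    using abs_poisson_bracket_in_chart[OF FG c] B(2)
    by (auto intro!: nn_integral_cong simp: ennreal_mult[symmetric] indicator_def subset_eq)
qed

text \<open>Coordinate balls play two roles: compact sets of finite area give local finiteness, and
  null spheres bound the pieces of the later decomposition.\<close>

lemma chart_cball_image:
  assumes c: "c \<in> A" and r: "cball x r \<subseteq> chart_image c"
  shows "compact (chart_inv c ` cball x r)" "emeasure area (chart_inv c ` cball x r) < \<infinity>"
    "emeasure area (chart_inv c ` sphere x r) = 0"
proof -
  have sub: "chart_inv c ` cball x r \<subseteq> chart_dom c" "sphere x r \<subseteq> chart_image c"
    using r chart_inv_in_dom[OF c] by auto
  have sub2: "chart_inv c ` sphere x r \<subseteq> chart_dom c"
    using sub by auto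
  have cont: "continuous_on (cball x r) (chart_inv c)" "continuous_on (sphere x r) (chart_inv c)"
    using continuous_on_subset[OF continuous_on_chart_inv[OF c]] r sub(2) by auto
  show cpt: "compact (chart_inv c ` cball x r)"
    by (intro compact_continuous_image cont) simp
  have cpt2: "compact (chart_inv c ` sphere x r)"
    by (intro compact_continuous_image cont) simp
  have im: "chart_map c ` (chart_inv c ` T) = T" if "T \<subseteq> chart_image c" for T
    using that chart_map_inv[OF c] by (force simp: image_image)
  have "compact (area_density c ` cball x r)"
    using continuous_on_subset[OF continuous_on_area_density[OF c] r] by (intro compact_continuous_image) auto
  then obtain b where b: "\<And>y. y \<in> cball x r \<Longrightarrow> \<bar>area_density c y\<bar> \<le> b"
    using compact_imp_bounded bounded_iff by (metis imageI real_norm_def)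
  have "emeasure area (chart_inv c ` cball x r) = (\<integral>\<^sup>+y\<in>cball x r. ennreal \<bar>area_density c y\<bar> \<partial>lborel)"
    using emeasure_area[OF c, of "chart_inv c ` cball x r"] emeasure_chart_measure[OF c _ sub(1)]
      cpt sub(1) im[OF r] by (simp add: compact_imp_closed)
  also have "\<dots> \<le> (\<integral>\<^sup>+y. ennreal b * indicator (cball x r) y \<partial>lborel)"
    using b by (intro nn_integral_mono) (auto simp: indicator_def intro: ennreal_leI)
  also have "\<dots> = ennreal b * emeasure lborel (cball x r)"
    by (simp add: nn_integral_cmult_indicator)
  also have "\<dots> < \<infinity>"
    using emeasure_lborel_cbox_finite emeasure_bounded_finite[of "cball x r"]
    by (simp add: ennreal_mult_less_top)
  finally show "emeasure area (chart_inv c ` cball x r) < \<infinity>" .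
  have "emeasure area (chart_inv c ` sphere x r) = (\<integral>\<^sup>+y\<in>sphere x r. ennreal \<bar>area_density c y\<bar> \<partial>lborel)"
    using emeasure_area[OF c, of "chart_inv c ` sphere x r"] emeasure_chart_measure[OF c _ sub2]
      cpt2 sub2 im[OF sub(2)] by (simp add: compact_imp_closed)
  also have "\<dots> = 0"
  proof -
    have "negligible (sphere x r)"
      by (rule negligible_sphere)
    then have "sphere x r \<in> null_sets lborel"
      by (simp add: negligible_iff_null_sets null_sets_completion_iff)
    then have "AE y in lborel. y \<notin> sphere x r"
      by (rule AE_not_in)
    then show ?thesis
      by (subst nn_integral_cong_AE[where v="\<lambda>_. 0"]) (auto simp: indicator_def)
  qed
  finally show "emeasure area (chart_inv c ` sphere x r) = 0" .
qed

lemma obtain_chart_ball: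
  assumes "open W" "q \<in> W"
  obtains c r where "c \<in> A" "0 < r" "q \<in> chart_dom c" "cball (chart_map c q) r \<subseteq> chart_image c"
    "chart_inv c ` cball (chart_map c q) r \<subseteq> W"
proof -
  obtain c where c: "c \<in> A" "q \<in> chart_dom c"
    by (rule obtain_chart)
  have "open (chart_map c ` (W \<inter> chart_dom c))"
    using open_chart_dom[OF c(1)] assms c(1) by (intro open_chart_map_image) auto
  moreover have "chart_map c q \<in> chart_map c ` (W \<inter> chart_dom c)"
    using assms(2) c(2) by blast
  ultimately obtain r where r: "0 < r" "cball (chart_map c q) r \<subseteq> chart_map c ` (W \<inter> chart_dom c)"
    by (meson open_contains_cball)
  show thesis
  proof (rule that[OF c(1) r(1) c(2)])
    show "cball (chart_map c q) r \<subseteq> chart_image c"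
      using r(2) by blast
    have "chart_inv c ` cball (chart_map c q) r \<subseteq> chart_inv c ` chart_map c ` (W \<inter> chart_dom c)"
      using r(2) by (rule image_mono)
    also have "\<dots> \<subseteq> W"
      using chart_inv_map[OF c(1)] by auto
    finally show "chart_inv c ` cball (chart_map c q) r \<subseteq> W" .
  qed
qed

lemma emeasure_area_compact:
  assumes K: "compact K"
  shows "emeasure area K < \<infinity>"
proof -
  have "\<exists>W. open W \<and> q \<in> W \<and> emeasure area W < \<infinity>" for q
  proof -
    obtain c r where cr: "c \<in> A" "0 < r" "q \<in> chart_dom c" "cball (chart_map c q) r \<subseteq> chart_image c"
      by (rule obtain_chart_ball[of UNIV q]) auto
    let ?W = "chart_inv c ` ball (chart_map c q) r"
    have "open ?W"
      using cr(4) ball_subset_cball by (intro open_chart_inv_image[OF cr(1)]) blast+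
    moreover have "q \<in> ?W"
      using cr chart_inv_map[OF cr(1,3)] by (metis centre_in_ball imageI)
    moreover have "emeasure area ?W \<le> emeasure area (chart_inv c ` cball (chart_map c q) r)"
      using chart_cball_image(1)[OF cr(1,4)] by (intro emeasure_mono image_mono ball_subset_cball) (simp add: compact_imp_closed)
    ultimately show ?thesis
      using chart_cball_image(2)[OF cr(1,4)] by (meson le_less_trans)
  qed
  then obtain W where W: "\<And>q. open (W q)" "\<And>q. q \<in> W q" "\<And>q. emeasure area (W q) < \<infinity>"
    by metis
  have "K \<subseteq> (\<Union>q\<in>K. W q)"
    using W(2) by blast
  then obtain T where T: "T \<subseteq> K" "finite T" "K \<subseteq> (\<Union>q\<in>T. W q)"
    using compactE_image[OF K, of K W] W(1) by blast
  have "emeasure area K \<le> emeasure area (\<Union>q\<in>T. W q)"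
    using T W(1) by (intro emeasure_mono) auto
  also have "\<dots> \<le> (\<Sum>q\<in>T. emeasure area (W q))"
    using W(1) T(2) by (intro emeasure_subadditive_finite) auto
  also have "\<dots> < \<infinity>"
    using W(3) T(2) by (simp add: sum_Pinfty less_top)
  finally show ?thesis .
qed

lemma integrable_area:
  fixes h :: "'m \<Rightarrow> real"
  assumes h: "continuous_on UNIV h" and K: "compact K" "\<And>q. q \<notin> K \<Longrightarrow> h q = 0"
  shows "integrable area h"
proof -
  have "compact (h ` K)"
    using continuous_on_subset[OF h] K(1) by (intro compact_continuous_image) auto
  then obtain b where "\<And>q. q \<in> K \<Longrightarrow> \<bar>h q\<bar> \<le> b"
    using compact_imp_bounded bounded_iff by (metis imageI real_norm_def)
  then show ?thesis
    using K emeasure_area_compact[OF K(1)] borel_measurable_continuous_onI[OF h]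
    by (intro integrableI_bounded_set[where A=K and B=b]) (auto simp: compact_imp_closed cong: measurable_cong_sets)
qed

text \<open>\<open>F\<close> vanishes near \<open>q\<close>, so its derivative vanishes at
  \<open>q\<close>. Together with continuity this makes powers of the bracket integrable.\<close>

lemma poisson_bracket_zero_outside_support:
  assumes FG: "smooth_fun A F" "smooth_fun A G" and q: "q \<notin> closure (support_on UNIV F)"
  shows "poisson_bracket A \<omega> F G q = 0"
proof -
  obtain c r where cr: "c \<in> A" "0 < r" "q \<in> chart_dom c" "cball (chart_map c q) r \<subseteq> chart_image c"
    "chart_inv c ` cball (chart_map c q) r \<subseteq> - closure (support_on UNIV F)"
    by (rule obtain_chart_ball[of "- closure (support_on UNIV F)" q]) (use q in auto)
  let ?x = "chart_map c q"
  have "F p = 0" if "p \<in> chart_inv c ` cball ?x r" for p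
    using that cr(5) closure_subset[of "support_on UNIV F"] by (auto simp: support_on_def)
  then have zero: "(F \<circ> chart_inv c) y = 0" if "y \<in> ball ?x r" for y
    using that by auto
  have "((\<lambda>_. 0) has_derivative (\<lambda>_. 0)) (at ?x)"
    by simp
  then have "(F \<circ> chart_inv c has_derivative (\<lambda>_. 0)) (at ?x)"
    by (rule has_derivative_transform_within_open[where s="ball ?x r"]) (use cr(2) zero in auto)
  then have "chart_deriv c F ?x = (\<lambda>_. 0)"
    by (rule frechet_derivative_at[symmetric])
  then have "jacobian c F G ?x = 0"
    by (simp add: jacobian_def)
  then show ?thesis
    using poisson_bracket_in_chart[OF FG cr(1,3)] area_density_nonzero[OF cr(1), of ?x] cr(3) by auto
qed

section \<open>Lower semicontinuity\<close>

abbreviation abs_bracket :: "('m \<Rightarrow> real) \<Rightarrow> ('m \<Rightarrow> real) \<Rightarrow> 'm \<Rightarrow> real" where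
  "abs_bracket F G q \<equiv> \<bar>poisson_bracket A \<omega> F G q\<bar>"

text \<open>Compact support is dropped, as the local argument uses only smoothness and a pointwise
  bound. \<open>C0_norm\<close>, a supremum of reals, would give no such bound for unbounded
  functions.\<close>

abbreviation uniformly_close :: "real \<Rightarrow> ('m \<Rightarrow> real) \<Rightarrow> ('m \<Rightarrow> real) \<Rightarrow> bool" where
  "uniformly_close \<delta> F' F \<equiv> smooth_fun A F' \<and> (\<forall>q. \<bar>F' q - F q\<bar> \<le> \<delta>)"

lemma borel_measurable_abs_bracket:
  assumes "smooth_fun A F" "smooth_fun A G"
  shows "abs_bracket F G \<in> borel_measurable borel"
  using borel_measurable_continuous_onI[OF continuous_abs_poisson_bracket[OF assms]] .

section \<open>Lower bounds on a single piece\<close>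

lemma bracket_integral_lower_semicontinuous:
  assumes FG: "smooth_fun A F" "smooth_fun A G" and c: "c \<in> A" and E: "open E" "E \<subseteq> chart_dom c"
    and inj: "inj_on (joint F G) E"
    and fin: "(\<integral>\<^sup>+q\<in>E. ennreal (abs_bracket F G q) \<partial>area) < \<infinity>" and "0 < \<eta>"
  shows "\<exists>\<delta>>0. \<forall>F' G'. uniformly_close \<delta> F' F \<longrightarrow> uniformly_close \<delta> G' G \<longrightarrow>
    (\<integral>\<^sup>+q\<in>E. ennreal (abs_bracket F G q) \<partial>area) \<le> (\<integral>\<^sup>+q\<in>E. ennreal (abs_bracket F' G' q) \<partial>area) + ennreal \<eta>"
proof -
  let ?S = "chart_map c ` E"
  have S: "open ?S" "?S \<subseteq> chart_image c"
    using open_chart_map_image[OF c E(2,1)] E by auto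
  have int: "(\<integral>\<^sup>+q\<in>E. ennreal (abs_bracket H K q) \<partial>area) =
      (\<integral>\<^sup>+x\<in>?S. ennreal \<bar>det (matrix (joint_deriv c H K x))\<bar> \<partial>lborel)"
    if "smooth_fun A H" "smooth_fun A K" for H K
    using nn_integral_poisson_bracket[OF that c _ E(2)] E(1) by (simp add: det_joint_deriv)
  have cont: "continuous_on ?S (\<lambda>x. det (matrix (joint_deriv c H K x)))"
    if "smooth_fun A H" "smooth_fun A K" for H K
    unfolding det_joint_deriv using continuous_on_subset[OF continuous_on_jacobian[OF that c] S(2)] .
  have der: "(joint H K \<circ> chart_inv c has_derivative joint_deriv c H K x) (at x)"
    if "smooth_fun A H" "smooth_fun A K" "x \<in> ?S" for H K x
    using has_derivative_joint[OF that(1,2) c] that(3) S(2) by blast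
  have "inj_on (joint F G \<circ> chart_inv c) ?S"
  proof (rule inj_onI)
    fix x y assume "x \<in> ?S" "y \<in> ?S" "(joint F G \<circ> chart_inv c) x = (joint F G \<circ> chart_inv c) y"
    then obtain q r where "q \<in> E" "x = chart_map c q" "r \<in> E" "y = chart_map c r"
      "joint F G (chart_inv c x) = joint F G (chart_inv c y)"
      by auto
    then show "x = y"
      using inj E(2) chart_inv_map[OF c] by (metis inj_onD subsetD)
  qed
  then obtain \<delta> where \<delta>: "0 < \<delta>" "\<And>g g'. (\<forall>x\<in>?S. (g has_derivative g' x) (at x)) \<Longrightarrow>
      continuous_on ?S (\<lambda>x. det (matrix (g' x))) \<Longrightarrow>
      (\<forall>x\<in>?S. dist (g x) ((joint F G \<circ> chart_inv c) x) \<le> \<delta>) \<Longrightarrow>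
      (\<integral>\<^sup>+x\<in>?S. ennreal \<bar>det (matrix (joint_deriv c F G x))\<bar> \<partial>lborel)
        \<le> (\<integral>\<^sup>+x\<in>?S. ennreal \<bar>det (matrix (g' x))\<bar> \<partial>lborel) + ennreal \<eta>"
    using jacobian_integral_lower_semicontinuous[OF S(1) _ der[OF FG] cont[OF FG] fin[unfolded int[OF FG]] \<open>0 < \<eta>\<close>]
    by blast
  show ?thesis
  \<comment> \<open>Half, because the planar distance is bounded by the sum of the errors of the two
    components.\<close>
  proof (intro exI[of _ "\<delta> / 2"] conjI allI impI)
    show "0 < \<delta> / 2" using \<delta>(1) by simp
    fix F' G' assume F': "uniformly_close (\<delta> / 2) F' F" and G': "uniformly_close (\<delta> / 2) G' G"
    have "dist (joint F' G' q) (joint F G q) \<le> \<delta>" for q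
    proof -
      have "\<bar>F' q - F q\<bar> \<le> \<delta> / 2" "\<bar>G' q - G q\<bar> \<le> \<delta> / 2"
        using F' G' by auto
      then show ?thesis
        using dist_joint[of F' G' q F G] by linarith
    qed
    then show "(\<integral>\<^sup>+q\<in>E. ennreal (abs_bracket F G q) \<partial>area) \<le> (\<integral>\<^sup>+q\<in>E. ennreal (abs_bracket F' G' q) \<partial>area) + ennreal \<eta>"
      unfolding int[OF FG] int[OF conjunct1[OF F'] conjunct1[OF G']]
      using der[OF conjunct1[OF F'] conjunct1[OF G']] cont[OF conjunct1[OF F'] conjunct1[OF G']]
      by (intro \<delta>(2)[of "joint F' G' \<circ> chart_inv c"]) auto
  qed
qed

text \<open>Integrating the tangent line inequality over \<open>E\<close> turns the first-power
  bound into one for the power \<open>p\<close>: the original integral is at least \<open>s\<close>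
  times the area, and \<open>(p - 1) * s powr p\<close> times the area cancels.\<close>

lemma bracket_powr_integral_lower_bound:
  assumes FG: "smooth_fun A F" "smooth_fun A G" and c: "c \<in> A" and E: "open E" "E \<subseteq> chart_dom c"
    and inj: "inj_on (joint F G) E" and finE: "emeasure area E < \<infinity>"
    and "0 < s" "1 \<le> p" and s: "\<And>q. q \<in> E \<Longrightarrow> s \<le> abs_bracket F G q"
    and b: "\<And>q. q \<in> E \<Longrightarrow> abs_bracket F G q \<le> b" and "0 < \<eta>"
  shows "\<exists>\<delta>>0. \<forall>F' G'. uniformly_close \<delta> F' F \<longrightarrow> uniformly_close \<delta> G' G \<longrightarrow>
    ennreal (s powr p) * emeasure area E \<le> (\<integral>\<^sup>+q\<in>E. ennreal (abs_bracket F' G' q powr p) \<partial>area) + ennreal \<eta>"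
proof -
  \<comment> \<open>The slope of the tangent at \<open>s\<close>. It multiplies the error, so the
    first-power estimate is requested with \<open>\<eta> / a\<close>.\<close>
  define a where "a = p * s powr (p - 1)"
  have a: "0 < a" "a * s = p * s powr p"
    using \<open>0 < s\<close> \<open>1 \<le> p\<close> by (simp_all add: a_def powr_diff)
  have "(\<integral>\<^sup>+q\<in>E. ennreal (abs_bracket F G q) \<partial>area) \<le> (\<integral>\<^sup>+q. ennreal b * indicator E q \<partial>area)"
    using b by (intro nn_integral_mono) (auto simp: indicator_def intro: ennreal_leI)
  also have "\<dots> = ennreal b * emeasure area E"
    using E(1) by (simp add: nn_integral_cmult_indicator)
  also have "\<dots> < \<infinity>"
    using finE by (simp add: ennreal_mult_less_top)
  finally have fin: "(\<integral>\<^sup>+q\<in>E. ennreal (abs_bracket F G q) \<partial>area) < \<infinity>" .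
  obtain \<delta> where \<delta>: "0 < \<delta>" "\<And>F' G'. uniformly_close \<delta> F' F \<Longrightarrow> uniformly_close \<delta> G' G \<Longrightarrow>
    (\<integral>\<^sup>+q\<in>E. ennreal (abs_bracket F G q) \<partial>area) \<le> (\<integral>\<^sup>+q\<in>E. ennreal (abs_bracket F' G' q) \<partial>area) + ennreal (\<eta> / a)"
    using bracket_integral_lower_semicontinuous[OF FG c E inj fin, of "\<eta> / a"] \<open>0 < \<eta>\<close> a(1) by auto
  have "ennreal (s powr p) * emeasure area E \<le> (\<integral>\<^sup>+q\<in>E. ennreal (abs_bracket F' G' q powr p) \<partial>area) + ennreal \<eta>"
    if F': "uniformly_close \<delta> F' F" and G': "uniformly_close \<delta> G' G" for F' G'
  proof -
    let ?J = "\<lambda>q. abs_bracket F' G' q" and ?m = "emeasure area E"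
    have [measurable]: "?J \<in> borel_measurable borel" "E \<in> sets borel"
      using borel_measurable_abs_bracket F' G' E(1) by auto
    have "ennreal s * ?m = (\<integral>\<^sup>+q. ennreal s * indicator E q \<partial>area)"
      using E(1) by (simp add: nn_integral_cmult_indicator)
    also have "\<dots> \<le> (\<integral>\<^sup>+q\<in>E. ennreal (abs_bracket F G q) \<partial>area)"
      using s by (intro nn_integral_mono) (auto simp: indicator_def intro: ennreal_leI)
    also have "\<dots> \<le> (\<integral>\<^sup>+q\<in>E. ennreal (?J q) \<partial>area) + ennreal (\<eta> / a)"
      by (rule \<delta>(2)[OF F' G'])
    finally have "ennreal a * (ennreal s * ?m) \<le> ennreal a * ((\<integral>\<^sup>+q\<in>E. ennreal (?J q) \<partial>area) + ennreal (\<eta> / a))"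
      by (rule mult_left_mono) simp
    also have "\<dots> = (\<integral>\<^sup>+q\<in>E. ennreal (a * ?J q) \<partial>area) + ennreal \<eta>"
      using a(1) \<open>0 < \<eta>\<close>
      by (simp add: distrib_left nn_integral_cmult[symmetric] ennreal_mult[symmetric] mult.assoc[symmetric])
    also have "(\<integral>\<^sup>+q\<in>E. ennreal (a * ?J q) \<partial>area)
        \<le> (\<integral>\<^sup>+q. ennreal (?J q powr p) * indicator E q + ennreal ((p - 1) * s powr p) * indicator E q \<partial>area)"
      using powr_tangent_bound[OF \<open>0 < s\<close> _ \<open>1 \<le> p\<close>] \<open>1 \<le> p\<close>
      by (intro nn_integral_mono) (auto simp: indicator_def a_def ennreal_plus[symmetric] simp del: ennreal_plus intro!: ennreal_leI)
    also have "\<dots> = (\<integral>\<^sup>+q\<in>E. ennreal (?J q powr p) \<partial>area) + ennreal ((p - 1) * s powr p) * ?m"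
      by (subst nn_integral_add) (simp_all add: nn_integral_cmult_indicator)
    finally have "ennreal (p * s powr p) * ?m \<le>
      ennreal ((p - 1) * s powr p) * ?m + ((\<integral>\<^sup>+q\<in>E. ennreal (?J q powr p) \<partial>area) + ennreal \<eta>)"
      using a \<open>0 < s\<close> by (simp add: mult.assoc[symmetric] ennreal_mult[symmetric] add_ac)
    moreover have "ennreal (p * s powr p) = ennreal ((p - 1) * s powr p) + ennreal (s powr p)"
      using \<open>1 \<le> p\<close> mult_right_mono[of 1 p "s powr p"]
      by (subst ennreal_plus[symmetric]) (simp_all add: left_diff_distrib)
    ultimately have "ennreal ((p - 1) * s powr p) * ?m + ennreal (s powr p) * ?m \<le>
      ennreal ((p - 1) * s powr p) * ?m + ((\<integral>\<^sup>+q\<in>E. ennreal (?J q powr p) \<partial>area) + ennreal \<eta>)"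
      by (simp add: distrib_right)
    \<comment> \<open>Finite area is what permits cancellation in \<open>ennreal\<close>.\<close>
    moreover have "ennreal ((p - 1) * s powr p) * ?m \<noteq> top"
      using finE by (simp add: ennreal_mult_eq_top_iff)
    ultimately show ?thesis
      by (simp add: ennreal_add_left_cancel_le)
  qed
  then show ?thesis
    using \<delta>(1) by blast
qed

section \<open>Good sets around points of nonzero bracket\<close>

lemma joint_locally_injective:
  assumes FG: "smooth_fun A F" "smooth_fun A G" and c: "c \<in> A" "open V" "x \<in> V" "V \<subseteq> chart_image c"
    and nz: "jacobian c F G x \<noteq> 0"
  obtains r where "0 < r" "cball x r \<subseteq> V" "inj_on (joint F G) (chart_inv c ` ball x r)"
proof -
  let ?f = "joint F G \<circ> chart_inv c" and ?f' = "joint_deriv c F G"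
  have der: "(?f has_derivative ?f' y) (at y)" if "y \<in> V" for y
    using has_derivative_joint[OF FG c(1)] that c(4) by blast
  have lin: "linear (?f' y)" if "y \<in> V" for y
    using has_derivative_linear[OF der[OF that]] .
  \<comment> \<open>A nonzero determinant gives the derivative a left inverse; with continuity of
    the derivative in operator norm this yields local injectivity.\<close>
  have "inj (?f' x)"
    using det_nz_iff_inj[OF lin[OF c(3)]] nz by (simp add: det_joint_deriv)
  then obtain g' where g': "linear g'" "g' \<circ> ?f' x = id"
    using linear_injective_left_inverse[OF lin[OF c(3)]] by blast
  have onorm: "\<exists>d>0. \<forall>y. dist x y < d \<longrightarrow> onorm (\<lambda>v. ?f' y v - ?f' x v) < e" if "0 < e" for e
  proof -
    have cont: "continuous_on V (\<lambda>y. ?f' y v)" for v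
      unfolding joint_deriv_def using continuous_on_chart_deriv[OF _ c(1)] FG c(4)
      by (intro continuous_intros) (auto intro: continuous_on_subset)
    have "\<exists>d>0. \<forall>y. dist y x < d \<longrightarrow> y \<in> V \<and> dist (?f' y v) (?f' x v) < e / 2" for v
    proof -
      have "isCont (\<lambda>y. ?f' y v) x"
        using cont[of v] c(2,3) continuous_on_eq_continuous_at by blast
      then obtain d1 where d1: "0 < d1" "\<And>y. dist y x < d1 \<Longrightarrow> dist (?f' y v) (?f' x v) < e / 2"
        using \<open>0 < e\<close> unfolding continuous_at_eps_delta by (meson half_gt_zero)
      obtain d2 where d2: "0 < d2" "\<And>y. dist y x < d2 \<Longrightarrow> y \<in> V"
        using c(2,3) unfolding open_dist by blast
      show ?thesis
        using d1 d2 by (intro exI[of _ "min d1 d2"]) auto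
    qed
    then obtain d where d: "\<And>v. 0 < d v" "\<And>v y. dist y x < d v \<Longrightarrow> y \<in> V \<and> dist (?f' y v) (?f' x v) < e / 2"
      by metis
    show ?thesis
    proof (intro exI[of _ "min (d (axis 1 1)) (d (axis 2 1))"] conjI allI impI)
      fix y assume y: "dist x y < min (d (axis 1 1)) (d (axis 2 1))"
      then have "y \<in> V" "dist (?f' y (axis 1 1)) (?f' x (axis 1 1)) < e / 2"
        "dist (?f' y (axis 2 1)) (?f' x (axis 2 1)) < e / 2"
        using d(2)[of y "axis 1 1"] d(2)[of y "axis 2 1"] by (auto simp: dist_commute)
      moreover have "linear (\<lambda>v. ?f' y v - ?f' x v)"
        using \<open>y \<in> V\<close> c(3) by (intro linear_compose_sub lin)
      ultimately show "onorm (\<lambda>v. ?f' y v - ?f' x v) < e"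
        using onorm_le_axis2[of "\<lambda>v. ?f' y v - ?f' x v"] by (simp add: dist_norm)
    qed (use d in auto)
  qed
  obtain r where r: "0 < r" "ball x r \<subseteq> V" "inj_on ?f (ball x r)"
    using has_derivative_locally_injective[OF c(3,2) _ g'(2) der onorm] g'(1)
    by (metis linear_conv_bounded_linear)
  show thesis
  \<comment> \<open>Halving the radius brings the closed ball, too, into \<open>V\<close>.\<close>
  proof (rule that[of "r / 2"])
    show "cball x (r / 2) \<subseteq> V"
      using r(1,2) by (force simp: subset_eq)
    show "inj_on (joint F G) (chart_inv c ` ball x (r / 2))"
      using r by (intro inj_on_imageI inj_on_subset[OF r(3)]) auto
  qed (use r in auto)
qed

text \<open>What one piece must supply to the tangent line estimate. The bound with
  \<open>\<kappa>\<close> says that replacing the bracket by \<open>s\<close> costs at most that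
  factor in the integral; \<open>b\<close> and the finite area keep the first-power integral finite.
  The property passes to open subsets, as making the pieces disjoint requires.\<close>

definition good_set :: "real \<Rightarrow> real \<Rightarrow> ('m \<Rightarrow> real) \<Rightarrow> ('m \<Rightarrow> real) \<Rightarrow> 'm set \<Rightarrow> bool" where
  "good_set p \<kappa> F G W \<longleftrightarrow> open W \<and> (\<exists>c\<in>A. W \<subseteq> chart_dom c) \<and> inj_on (joint F G) W \<and>
     (\<exists>s>0. \<exists>b. \<forall>q\<in>W. s \<le> abs_bracket F G q \<and> abs_bracket F G q \<le> b \<and> abs_bracket F G q powr p \<le> \<kappa> * s powr p) \<and>
     emeasure area W < \<infinity>"

lemma good_set_subset:
  assumes "good_set p \<kappa> F G W" "open E" "E \<subseteq> W"
  shows "good_set p \<kappa> F G E"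
proof -
  have "emeasure area E \<le> emeasure area W"
    using assms by (intro emeasure_mono) (auto simp: good_set_def)
  then show ?thesis
    using assms unfolding good_set_def by (meson inj_on_subset le_less_trans subset_iff)
qed

lemma obtain_good_set:
  assumes FG: "smooth_fun A F" "smooth_fun A G" and p: "1 \<le> p" and \<kappa>: "1 < \<kappa>"
    and q: "abs_bracket F G q \<noteq> 0"
  shows "\<exists>W. good_set p \<kappa> F G W \<and> q \<in> W \<and> emeasure area (closure W - W) = 0"
proof -
  define J where "J = abs_bracket F G"
  \<comment> \<open>The exponent makes \<open>J q\<close> the geometric mean of \<open>s\<close> and
    \<open>s * \<kappa> powr (1 / p)\<close>, strictly between them, so a whole neighbourhood stays
    in this window.\<close>
  define s where "s = J q / \<kappa> powr (1 / (2 * p))"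
  have J: "continuous_on UNIV J"
    unfolding J_def by (rule continuous_abs_poisson_bracket[OF FG])
  have "0 < J q"
    using q by (simp add: J_def)
  have pow: "1 < \<kappa> powr (1 / (2 * p))"
    using \<kappa> p by (simp add: gr_one_powr)
  have "0 < s"
    unfolding s_def using \<open>0 < J q\<close> pow by (intro divide_pos_pos) linarith+
  moreover have "s * 1 < s * \<kappa> powr (1 / (2 * p))"
    using \<open>0 < s\<close> pow by (rule mult_strict_left_mono[rotated])
  ultimately have s: "0 < s" "s < J q"
    using pow \<kappa> by (simp_all add: s_def)
  have "J q = s * \<kappa> powr (1 / (2 * p))"
    using pow \<kappa> by (simp add: s_def)
  also have "\<dots> < s * \<kappa> powr (1 / p)"
    using s(1) \<kappa> p by (intro mult_strict_left_mono powr_less_mono) (auto simp: field_simps)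
  finally have upper: "J q < s * \<kappa> powr (1 / p)" .
  obtain c where c: "c \<in> A" "q \<in> chart_dom c"
    by (rule obtain_chart)
  define W0 where "W0 = {y. s < J y} \<inter> {y. J y < s * \<kappa> powr (1 / p)} \<inter> chart_dom c"
  have W0: "open W0" "q \<in> W0" "W0 \<subseteq> chart_dom c"
    unfolding W0_def using s upper c open_chart_dom[OF c(1)]
    by (auto intro!: open_Int open_Collect_less J continuous_on_const)
  have "jacobian c F G (chart_map c q) \<noteq> 0"
    using poisson_bracket_in_chart[OF FG c] area_density_nonzero[OF c(1), of "chart_map c q"] q c(2) by auto
  then obtain r where r: "0 < r" "cball (chart_map c q) r \<subseteq> chart_map c ` W0"
    "inj_on (joint F G) (chart_inv c ` ball (chart_map c q) r)"
    using joint_locally_injective[OF FG c(1) open_chart_map_image[OF c(1) W0(3,1)] imageI[OF W0(2)] image_mono[OF W0(3)]]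
    by blast
  define W where "W = chart_inv c ` ball (chart_map c q) r"
  let ?C = "chart_inv c ` cball (chart_map c q) r"
  have sub: "cball (chart_map c q) r \<subseteq> chart_image c"
    using r(2) W0(3) by blast
  note C = chart_cball_image[OF c(1) sub]
  have W: "open W"
    unfolding W_def using sub ball_subset_cball by (intro open_chart_inv_image[OF c(1)]) blast+
  have WC: "W \<subseteq> ?C"
    unfolding W_def by (intro image_mono ball_subset_cball)
  have "?C \<subseteq> chart_inv c ` (chart_map c ` W0)"
    using r(2) by (rule image_mono)
  also have "\<dots> \<subseteq> W0"
    using chart_inv_map[OF c(1)] W0(3) by auto
  finally have CW0: "?C \<subseteq> W0" .
  have bounds: "s \<le> J y \<and> J y \<le> s * \<kappa> powr (1 / p) \<and> J y powr p \<le> \<kappa> * s powr p" if "y \<in> W" for y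
  proof -
    have y: "s < J y" "J y < s * \<kappa> powr (1 / p)"
      using that WC CW0 by (auto simp: W0_def)
    then have "J y powr p \<le> (s * \<kappa> powr (1 / p)) powr p"
      using s(1) p by (intro powr_mono2) auto
    also have "\<dots> = \<kappa> * s powr p"
      using s(1) p \<kappa> by (simp add: powr_mult powr_powr)
    finally show ?thesis
      using y by simp
  qed
  have "good_set p \<kappa> F G W"
    unfolding good_set_def
  proof (intro conjI)
    show "\<exists>c\<in>A. W \<subseteq> chart_dom c"
      using WC CW0 W0(3) c(1) by blast
    show "\<exists>s>0. \<exists>b. \<forall>q\<in>W. s \<le> abs_bracket F G q \<and> abs_bracket F G q \<le> b \<and> abs_bracket F G q powr p \<le> \<kappa> * s powr p"
      using bounds s(1) unfolding J_def by blast
    have "emeasure area W \<le> emeasure area ?C"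
      using WC C(1) by (intro emeasure_mono) (simp_all add: compact_imp_closed)
    then show "emeasure area W < \<infinity>"
      using C(2) by (rule le_less_trans)
  qed (use W r(3) in \<open>auto simp: W_def\<close>)
  moreover have "q \<in> W"
    unfolding W_def using r(1) chart_inv_map[OF c] by (metis centre_in_ball imageI)
  moreover have "emeasure area (closure W - W) = 0"
  proof -
    \<comment> \<open>A compact set is closed here, so the closure adds at most the image of the
      bounding sphere.\<close>
    have "closure W \<subseteq> ?C"
      using closure_minimal[OF WC] C(1) by (simp add: compact_imp_closed)
    moreover have "?C - W \<subseteq> chart_inv c ` sphere (chart_map c q) r"
      unfolding W_def by (force simp: image_iff)
    ultimately have "closure W - W \<subseteq> chart_inv c ` sphere (chart_map c q) r"
      by blast
    moreover have "compact (chart_inv c ` sphere (chart_map c q) r)"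
      using sub continuous_on_subset[OF continuous_on_chart_inv[OF c(1)], of "sphere (chart_map c q) r"]
      by (intro compact_continuous_image) (auto simp: subset_eq)
    ultimately have "emeasure area (closure W - W) \<le> emeasure area (chart_inv c ` sphere (chart_map c q) r)"
      by (intro emeasure_mono) (simp_all add: compact_imp_closed)
    then show ?thesis
      using C(3) by simp
  qed
  ultimately show ?thesis
    by blast
qed

section \<open>From the C0 norm to pointwise closeness\<close>

lemma continuous_on_smooth_fun:
  assumes "smooth_fun A H"
  shows "continuous_on UNIV H"
proof -
  have "isCont H q" for q
  proof -
    obtain c where c: "c \<in> A" "q \<in> chart_dom c"
      by (rule obtain_chart)
    have "continuous_on (chart_image c) (H \<circ> chart_inv c)"
      using assms c(1) unfolding smooth_fun_def by (blast intro: smooth_on_imp_continuous_on)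
    then have "continuous_on (chart_dom c) ((H \<circ> chart_inv c) \<circ> chart_map c)"
      by (rule continuous_on_compose[OF continuous_on_chart_map[OF c(1)]])
    then have "continuous_on (chart_dom c) H"
      by (rule continuous_on_eq) (simp add: chart_inv_map c(1))
    then show ?thesis
      using c open_chart_dom continuous_on_eq_continuous_at by blast
  qed
  then show ?thesis
    by (simp add: continuous_at_imp_continuous_on)
qed

lemma smooth_compact_support_bounded:
  assumes "H \<in> smooth_compact_support A"
  obtains b where "\<And>q. \<bar>H q\<bar> \<le> b"
proof -
  let ?K = "closure (support_on UNIV H)"
  have H: "smooth_fun A H" "compact ?K"
    using assms by (auto simp: smooth_compact_support_def)
  have "compact (H ` ?K)"
    using continuous_on_subset[OF continuous_on_smooth_fun[OF H(1)]] H(2) by (intro compact_continuous_image) auto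
  then obtain b where b: "\<And>q. q \<in> ?K \<Longrightarrow> \<bar>H q\<bar> \<le> b"
    using compact_imp_bounded bounded_iff by (metis imageI real_norm_def)
  have "\<bar>H q\<bar> \<le> max b 0" for q
  proof (cases "q \<in> ?K")
    case False
    then have "H q = 0"
      using closure_subset[of "support_on UNIV H"] by (auto simp: support_on_def)
    then show ?thesis by simp
  qed (use b in \<open>simp add: le_max_iff_disj\<close>)
  then show thesis
    by (rule that)
qed

text \<open>On the reals, \<open>SUP\<close> dominates its members only for sets bounded above;
  compact support of both functions provides the bound.\<close>

lemma uniformly_close_if_C0_norm_le:
  assumes "F \<in> smooth_compact_support A" "F' \<in> smooth_compact_support A"
    and "C0_norm (\<lambda>q. F' q - F q) \<le> \<delta>"
  shows "uniformly_close \<delta> F' F"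
proof -
  obtain a b where ab: "\<And>q. \<bar>F q\<bar> \<le> a" "\<And>q. \<bar>F' q\<bar> \<le> b"
    using smooth_compact_support_bounded assms(1,2) by metis
  have "bdd_above (range (\<lambda>q. \<bar>F' q - F q\<bar>))"
  proof (rule bdd_aboveI2)
    show "\<bar>F' q - F q\<bar> \<le> a + b" for q
      using ab[of q] by linarith
  qed
  then have "\<bar>F' q - F q\<bar> \<le> C0_norm (\<lambda>q. F' q - F q)" for q
    unfolding C0_norm_def by (rule cSUP_upper[rotated]) simp
  then show ?thesis
    using assms(2,3) order_trans by (auto simp: smooth_compact_support_def)
qed

section \<open>Decomposition into good sets and summation over them\<close>

lemma obtain_good_partition:
  assumes FG: "smooth_fun A F" "smooth_fun A G" and p: "1 \<le> p" and \<kappa>: "1 < \<kappa>"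
  obtains E :: "nat \<Rightarrow> 'm set" where "\<forall>n. good_set p \<kappa> F G (E n)" "disjoint_family E"
    "AE q in area. q \<notin> (\<Union>n. E n) \<longrightarrow> poisson_bracket A \<omega> F G q = 0"
proof -
  define \<W> where "\<W> = {W. good_set p \<kappa> F G W \<and> emeasure area (closure W - W) = 0}"
  have "open W" if "W \<in> \<W>" for W
    using that by (simp add: \<W>_def good_set_def)
  then obtain \<F> where \<F>: "\<F> \<subseteq> \<W>" "countable \<F>" "\<Union>\<F> = \<Union>\<W>"
    using Lindelof[of \<W>] by metis
  obtain c where "c \<in> A"
    by (rule obtain_chart)
  \<comment> \<open>The empty set is adjoined to \<open>\<F>\<close> so that there is an enumeration
    even if \<open>\<F>\<close> is empty, as may happen for an identically vanishing
    bracket.\<close>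
  have "{} \<in> \<W>"
    unfolding \<W>_def good_set_def mem_Collect_eq
    by (intro conjI bexI[OF _ \<open>c \<in> A\<close>] exI[of _ 1]) simp_all
  define D where "D = from_nat_into (insert {} \<F>)"
  have range: "range D = insert {} \<F>"
    unfolding D_def using \<F>(2) by (intro range_from_nat_into) auto
  have D: "good_set p \<kappa> F G (D n)" "emeasure area (closure (D n) - D n) = 0" "open (D n)" for n
  proof -
    have "D n \<in> \<W>"
      using range \<F>(1) \<open>{} \<in> \<W>\<close> by (metis insertE rangeI subsetD)
    then show "good_set p \<kappa> F G (D n)" "emeasure area (closure (D n) - D n) = 0" "open (D n)"
      by (auto simp: \<W>_def good_set_def)
  qed
  \<comment> \<open>Removing closures keeps the pieces open and costs only the null sets \<open>closure (D j) - D j\<close>.\<close>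
  define E where "E n = D n - (\<Union>j<n. closure (D j))" for n
  show thesis
  proof (rule that[of E])
    have "open (E n)" for n
      unfolding E_def by (intro open_Diff D closed_UN) auto
    then show "\<forall>n. good_set p \<kappa> F G (E n)"
      using good_set_subset[OF D(1)] by (auto simp: E_def)
    have "E i \<inter> E j = {}" if "i < j" for i j
      using that closure_subset[of "D i"] by (auto simp: E_def)
    then show "disjoint_family E"
      unfolding disjoint_family_on_def by (metis Int_commute linorder_neqE_nat)
    have "AE q in area. \<forall>n. q \<notin> closure (D n) - D n"
      unfolding AE_all_countable
    proof
      fix n
      show "AE q in area. q \<notin> closure (D n) - D n"
        using D(2,3)[of n] by (intro AE_not_in) (auto simp: null_sets_def)
    qed
    then show "AE q in area. q \<notin> (\<Union>n. E n) \<longrightarrow> poisson_bracket A \<omega> F G q = 0"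
    proof eventually_elim
      case (elim q)
      show ?case
      proof (intro impI, rule ccontr)
        assume q: "q \<notin> (\<Union>n. E n)" "poisson_bracket A \<omega> F G q \<noteq> 0"
        have "q \<in> \<Union>\<W>"
          using obtain_good_set[OF FG p \<kappa>, of q] q(2) by (auto simp: \<W>_def)
        then have "\<exists>n. q \<in> D n"
          using \<F>(3) range by (metis UnionE imageE insertCI)
        \<comment> \<open>Sets \<open>D j\<close> before the first one containing \<open>q\<close>
          miss it; off the exceptional null sets, so do their closures.\<close>
        define n where "n = (LEAST n. q \<in> D n)"
        have n: "q \<in> D n" "\<And>j. j < n \<Longrightarrow> q \<notin> D j"
          using LeastI_ex[OF \<open>\<exists>n. q \<in> D n\<close>] not_less_Least unfolding n_def by auto
        then have "q \<in> E n"
          using elim by (auto simp: E_def)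
        then show False
          using q(1) by blast
      qed
    qed
  qed
qed

text \<open>A level \<open>a\<close> below the integral, rather than a subtracted error, also covers
  an infinite integral. The gap is spent twice: from \<open>b\<close> down to \<open>d\<close> on
  the factor \<open>\<kappa>\<close>, from \<open>d\<close> down to \<open>a\<close> on the additive
  errors of the pieces.\<close>

lemma bracket_powr_integral_lower_semicontinuous:
  assumes FG: "smooth_fun A F" "smooth_fun A G" and p: "1 \<le> p" and "0 \<le> a"
    and a: "ennreal a < (\<integral>\<^sup>+q. ennreal (abs_bracket F G q powr p) \<partial>area)"
  shows "\<exists>\<delta>>0. \<forall>F' G'. uniformly_close \<delta> F' F \<longrightarrow> uniformly_close \<delta> G' G \<longrightarrow>
    ennreal a \<le> (\<integral>\<^sup>+q. ennreal (abs_bracket F' G' q powr p) \<partial>area)"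
proof -
  have meas: "(\<lambda>q. ennreal (abs_bracket H K q powr p)) \<in> borel_measurable area"
    if "smooth_fun A H" "smooth_fun A K" for H K
    using borel_measurable_abs_bracket[OF that] by measurable
  obtain b where b: "a < b" "ennreal b < (\<integral>\<^sup>+q. ennreal (abs_bracket F G q powr p) \<partial>area)"
  proof -
    obtain b' where "ennreal a < b'" "b' < (\<integral>\<^sup>+q. ennreal (abs_bracket F G q powr p) \<partial>area)"
      using dense[OF a] by blast
    then show thesis
      using that \<open>0 \<le> a\<close> by (cases b') (auto simp: ennreal_less_iff)
  qed
  obtain d where d: "a < d" "d < b"
    using dense[OF b(1)] by blast
  define \<kappa> where "\<kappa> = b / d"
  have \<kappa>: "1 < \<kappa>" "b = \<kappa> * d"
    using d \<open>0 \<le> a\<close> by (simp_all add: \<kappa>_def)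
  obtain E :: "nat \<Rightarrow> 'm set" where E: "\<forall>n. good_set p \<kappa> F G (E n)" "disjoint_family E"
    "AE q in area. q \<notin> (\<Union>n. E n) \<longrightarrow> poisson_bracket A \<omega> F G q = 0"
    by (rule obtain_good_partition[OF FG p \<kappa>(1)])
  have openE: "open (E n)" for n
    using E(1) by (simp add: good_set_def)
  then have borelE: "E n \<in> sets area" for n
    by simp
  have "\<forall>n. \<exists>s>0. \<exists>b. \<forall>q\<in>E n. s \<le> abs_bracket F G q \<and> abs_bracket F G q \<le> b \<and> abs_bracket F G q powr p \<le> \<kappa> * s powr p"
    using E(1) by (simp add: good_set_def)
  then obtain s B where s: "\<And>n. 0 < s n" "\<And>n q. q \<in> E n \<Longrightarrow> s n \<le> abs_bracket F G q"
    "\<And>n q. q \<in> E n \<Longrightarrow> abs_bracket F G q \<le> B n"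
    "\<And>n q. q \<in> E n \<Longrightarrow> abs_bracket F G q powr p \<le> \<kappa> * s n powr p"
    by metis
  define m where "m n = ennreal (s n powr p) * emeasure area (E n)" for n
  have "(\<integral>\<^sup>+q. ennreal (abs_bracket F G q powr p) \<partial>area) = (\<integral>\<^sup>+q\<in>(\<Union>n. E n). ennreal (abs_bracket F G q powr p) \<partial>area)"
    using E(3) by (intro nn_integral_cong_AE) (auto elim!: eventually_mono simp: indicator_def)
  also have "\<dots> = (\<Sum>n. \<integral>\<^sup>+q\<in>E n. ennreal (abs_bracket F G q powr p) \<partial>area)"
    by (intro nn_integral_disjoint_family meas FG borelE E(2))
  finally have "ennreal b < (\<Sum>n. \<integral>\<^sup>+q\<in>E n. ennreal (abs_bracket F G q powr p) \<partial>area)"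
    using b(2) by simp
  \<comment> \<open>Finitely many pieces already exceed \<open>b\<close>; over infinitely many, the
    admissible \<delta> could shrink to zero.\<close>
  then obtain N where N: "ennreal b < (\<Sum>n<N. \<integral>\<^sup>+q\<in>E n. ennreal (abs_bracket F G q powr p) \<partial>area)"
    by (auto simp: suminf_eq_SUP less_SUP_iff)
  have "(\<integral>\<^sup>+q\<in>E n. ennreal (abs_bracket F G q powr p) \<partial>area) \<le> ennreal \<kappa> * m n" for n
  proof -
    have "(\<integral>\<^sup>+q\<in>E n. ennreal (abs_bracket F G q powr p) \<partial>area) \<le> (\<integral>\<^sup>+q. ennreal (\<kappa> * s n powr p) * indicator (E n) q \<partial>area)"
      using s(4) by (intro nn_integral_mono) (auto simp: indicator_def intro: ennreal_leI)
    also have "\<dots> = ennreal (\<kappa> * s n powr p) * emeasure area (E n)"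
      using borelE by (simp add: nn_integral_cmult_indicator)
    also have "\<dots> = ennreal \<kappa> * m n"
      using \<kappa>(1) by (simp add: m_def ennreal_mult mult.assoc)
    finally show ?thesis .
  qed
  then have b_less: "ennreal b < ennreal \<kappa> * (\<Sum>n<N. m n)"
    unfolding sum_distrib_left by (intro less_le_trans[OF N] sum_mono)
  have d_less: "ennreal d \<le> (\<Sum>n<N. m n)"
  proof -
    have "ennreal \<kappa> * ennreal d \<le> ennreal \<kappa> * (\<Sum>n<N. m n)"
      using b_less \<kappa> d \<open>0 \<le> a\<close> by (simp add: ennreal_mult less_imp_le)
    then show ?thesis
      using \<kappa>(1) by (subst (asm) ennreal_mult_le_mult_iff) auto
  qed
  \<comment> \<open>\<open>N\<close> errors of this size stay within \<open>d - a\<close>;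
    \<open>Suc N\<close> spares a case distinction on \<open>N = 0\<close>.\<close>
  define \<eta> where "\<eta> = (d - a) / real (Suc N)"
  have \<eta>: "0 < \<eta>" "real N * \<eta> \<le> d - a"
    using d by (simp_all add: \<eta>_def field_simps)
  define works where "works n \<delta> \<longleftrightarrow> (\<forall>F' G'. uniformly_close \<delta> F' F \<longrightarrow> uniformly_close \<delta> G' G \<longrightarrow>
    m n \<le> (\<integral>\<^sup>+q\<in>E n. ennreal (abs_bracket F' G' q powr p) \<partial>area) + ennreal \<eta>)" for n \<delta>
  have "\<exists>\<delta>>0. works n \<delta>" for n
  proof -
    obtain c where c: "c \<in> A" "E n \<subseteq> chart_dom c"
      using E(1) unfolding good_set_def by blast
    have "inj_on (joint F G) (E n)" "emeasure area (E n) < \<infinity>"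
      using E(1) by (auto simp: good_set_def)
    then show ?thesis
      unfolding works_def m_def
      using bracket_powr_integral_lower_bound[OF FG c(1) openE c(2) _ _ s(1) p s(2,3) \<eta>(1)] by blast
  qed
  then obtain \<delta> where \<delta>: "\<And>n. 0 < \<delta> n" "\<And>n. works n (\<delta> n)"
    by metis
  \<comment> \<open>The inserted \<open>1\<close> keeps the set nonempty for every
    \<open>N\<close>.\<close>
  define \<epsilon> where "\<epsilon> = Min (insert 1 (\<delta> ` {..<N}))"
  have \<epsilon>: "0 < \<epsilon>" "\<And>n. n < N \<Longrightarrow> \<epsilon> \<le> \<delta> n"
    using \<delta>(1) by (auto simp: \<epsilon>_def)
  have "ennreal a \<le> (\<integral>\<^sup>+q. ennreal (abs_bracket F' G' q powr p) \<partial>area)"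
    if F': "uniformly_close \<epsilon> F' F" and G': "uniformly_close \<epsilon> G' G" for F' G'
  proof -
    let ?J = "\<lambda>q. ennreal (abs_bracket F' G' q powr p)"
    have close: "uniformly_close (\<delta> n) F' F" "uniformly_close (\<delta> n) G' G" if "n < N" for n
      using F' G' \<epsilon>(2)[OF that] order_trans by blast+
    have "(\<Sum>n<N. m n) \<le> (\<Sum>n<N. (\<integral>\<^sup>+q\<in>E n. ?J q \<partial>area) + ennreal \<eta>)"
      using \<delta>(2) close unfolding works_def by (intro sum_mono) blast
    also have "\<dots> = (\<Sum>n<N. \<integral>\<^sup>+q\<in>E n. ?J q \<partial>area) + ennreal (real N * \<eta>)"
      using \<eta>(1) by (simp add: sum.distrib ennreal_mult ennreal_of_nat_eq_real_of_nat)
    also have "(\<Sum>n<N. \<integral>\<^sup>+q\<in>E n. ?J q \<partial>area) \<le> (\<Sum>n. \<integral>\<^sup>+q\<in>E n. ?J q \<partial>area)"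
      by (rule sum_le_suminf) auto
    also have "(\<Sum>n. \<integral>\<^sup>+q\<in>E n. ?J q \<partial>area) = (\<integral>\<^sup>+q\<in>(\<Union>n. E n). ?J q \<partial>area)"
      using F' G' by (intro nn_integral_disjoint_family[symmetric] meas borelE E(2)) auto
    also have "\<dots> \<le> (\<integral>\<^sup>+q. ?J q \<partial>area)"
      by (intro nn_integral_mono) (simp add: indicator_def)
    also have "ennreal (real N * \<eta>) \<le> ennreal (d - a)"
      using \<eta>(2) by (rule ennreal_leI)
    finally have "(\<Sum>n<N. m n) \<le> (\<integral>\<^sup>+q. ?J q \<partial>area) + ennreal (d - a)"
      by (simp add: add_mono)
    then have "ennreal (d - a) + ennreal a \<le> ennreal (d - a) + (\<integral>\<^sup>+q. ?J q \<partial>area)"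
      using d_less d \<open>0 \<le> a\<close> by (simp add: ennreal_plus[symmetric] add.commute del: ennreal_plus)
    then show ?thesis
      by (simp add: ennreal_add_left_cancel_le)
  qed
  then show ?thesis
    using \<epsilon>(1) by blast
qed

text \<open>\<open>LINT\<close> defaults to 0 on nonintegrable functions, so the perturbed pairs
  need integrability as much as \<open>F\<close> and \<open>G\<close> do; otherwise the bound could
  not pass to \<open>Lp_norm\<close>.\<close>

lemma nn_integral_bracket_powr:
  assumes F: "F \<in> smooth_compact_support A" and G: "G \<in> smooth_compact_support A" and p: "1 \<le> p"
  shows "(\<integral>\<^sup>+q. ennreal (abs_bracket F G q powr p) \<partial>area) = ennreal (LINT q|area. abs_bracket F G q powr p)"
proof (rule nn_integral_eq_integral)
  have FG: "smooth_fun A F" "smooth_fun A G" and K: "compact (closure (support_on UNIV F))"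
    using F G by (auto simp: smooth_compact_support_def)
  show "integrable area (\<lambda>q. abs_bracket F G q powr p)"
  proof (rule integrable_area[OF _ K])
    show "continuous_on UNIV (\<lambda>q. abs_bracket F G q powr p)"
      \<comment> \<open>Positivity of the exponent gives continuity at the zeros of the
        bracket.\<close>
      using p by (intro continuous_on_powr' continuous_abs_poisson_bracket FG continuous_on_const) auto
  qed (use poisson_bracket_zero_outside_support[OF FG] in auto)
qed simp

lemma Lp_norm_alt: "Lp_norm area p UNIV (poisson_bracket A \<omega> F G) = (LINT q|area. abs_bracket F G q powr p) powr (1 / p)"
  by (simp add: Lp_norm_def set_lebesgue_integral_def)

lemma Lp_norm_bracket_lower_semicontinuous:
  assumes F: "F \<in> smooth_compact_support A" and G: "G \<in> smooth_compact_support A" and p: "1 \<le> p"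
    and l: "0 \<le> l" "l < Lp_norm area p UNIV (poisson_bracket A \<omega> F G)"
  shows "\<exists>\<delta>>0. \<forall>F'\<in>smooth_compact_support A. \<forall>G'\<in>smooth_compact_support A.
    C0_norm (\<lambda>q. F' q - F q) \<le> \<delta> \<longrightarrow> C0_norm (\<lambda>q. G' q - G q) \<le> \<delta> \<longrightarrow>
    l \<le> Lp_norm area p UNIV (poisson_bracket A \<omega> F' G')"
proof -
  have FG: "smooth_fun A F" "smooth_fun A G"
    using F G by (auto simp: smooth_compact_support_def)
  have "l powr p < (Lp_norm area p UNIV (poisson_bracket A \<omega> F G)) powr p"
    using l p by (intro powr_less_mono2) auto
  also have "\<dots> = (LINT q|area. abs_bracket F G q powr p)"
    using p by (simp add: Lp_norm_alt powr_powr)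
  finally have "ennreal (l powr p) < (\<integral>\<^sup>+q. ennreal (abs_bracket F G q powr p) \<partial>area)"
    unfolding nn_integral_bracket_powr[OF F G p] by (simp add: ennreal_less_iff)
  then obtain \<delta> where \<delta>: "0 < \<delta>" "\<And>F' G'. uniformly_close \<delta> F' F \<Longrightarrow> uniformly_close \<delta> G' G \<Longrightarrow>
    ennreal (l powr p) \<le> (\<integral>\<^sup>+q. ennreal (abs_bracket F' G' q powr p) \<partial>area)"
    using bracket_powr_integral_lower_semicontinuous[OF FG p] by (metis powr_ge_zero)
  have "l \<le> Lp_norm area p UNIV (poisson_bracket A \<omega> F' G')"
    if F': "F' \<in> smooth_compact_support A" and G': "G' \<in> smooth_compact_support A"
      and "C0_norm (\<lambda>q. F' q - F q) \<le> \<delta>" "C0_norm (\<lambda>q. G' q - G q) \<le> \<delta>" for F' G'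
  proof -
    have "ennreal (l powr p) \<le> ennreal (LINT q|area. abs_bracket F' G' q powr p)"
      unfolding nn_integral_bracket_powr[OF F' G' p, symmetric]
      using uniformly_close_if_C0_norm_le[OF F F' that(3)] uniformly_close_if_C0_norm_le[OF G G' that(4)]
      by (rule \<delta>(2))
    then have "l powr p \<le> (LINT q|area. abs_bracket F' G' q powr p)"
      by (simp add: ennreal_le_iff integral_nonneg_AE)
    then have "(l powr p) powr (1 / p) \<le> Lp_norm area p UNIV (poisson_bracket A \<omega> F' G')"
      unfolding Lp_norm_alt using p by (intro powr_mono2) auto
    then show ?thesis
      using l(1) p by (simp add: powr_powr)
  qed
  then show ?thesis
    using \<delta>(1) by blast
qed

end

theorem theorem1p4:
  fixes A :: "('m::{t2_space, second_countable_topology}, real^2) chart set"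
    and \<omega> :: "('m, real^2) form2"
    and p :: real
    and F G :: "'m \<Rightarrow> real"
  assumes "symplectic_manifold A \<omega>"
    and "1 \<le> p"
    and "F \<in> smooth_compact_support A"
    and "G \<in> smooth_compact_support A"
  shows "(SUP \<delta>\<in>{0<..}. Inf {Lp_norm (area_measure A \<omega>) p UNIV (poisson_bracket A \<omega> F' G') | F' G'.
            F' \<in> smooth_compact_support A \<and> G' \<in> smooth_compact_support A \<and>
            C0_norm (\<lambda>x. F' x - F x) \<le> \<delta> \<and> C0_norm (\<lambda>x. G' x - G x) \<le> \<delta>})
         = Lp_norm (area_measure A \<omega>) p UNIV (poisson_bracket A \<omega> F G)"
proof -
  interpret symplectic_surface A \<omega>
    using assms(1) by unfold_locales
  let ?N = "\<lambda>F' G'. Lp_norm area p UNIV (poisson_bracket A \<omega> F' G')"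
  define S where "S \<delta> = {?N F' G' | F' G'. F' \<in> smooth_compact_support A \<and> G' \<in> smooth_compact_support A \<and>
    C0_norm (\<lambda>x. F' x - F x) \<le> \<delta> \<and> C0_norm (\<lambda>x. G' x - G x) \<le> \<delta>}" for \<delta>
  \<comment> \<open>The unperturbed pair is admissible for every \<delta>, so each set is nonempty
    and no infimum exceeds the norm for \<open>F\<close> and \<open>G\<close>.\<close>
  have mem: "?N F G \<in> S \<delta>" if "0 < \<delta>" for \<delta>
    unfolding S_def mem_Collect_eq using assms(3,4) that
    by (intro exI[of _ F] exI[of _ G]) (simp add: C0_norm_def)
  have nonneg: "0 \<le> ?N F' G'" for F' G'
    by (simp add: Lp_norm_def)
  \<comment> \<open>\<open>Inf\<close> and \<open>SUP\<close> on the reals behave well only for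
    nonempty bounded sets: 0 bounds each set below, and the norm for \<open>F\<close> and
    \<open>G\<close> bounds the infima above.\<close>
  have bdd: "bdd_below (S \<delta>)" for \<delta>
    unfolding S_def by (intro bdd_belowI[of _ 0]) (use nonneg in auto)
  have upper: "Inf (S \<delta>) \<le> ?N F G" if "0 < \<delta>" for \<delta>
    using mem[OF that] bdd by (rule cInf_lower)
  have bdd_above: "bdd_above ((\<lambda>\<delta>. Inf (S \<delta>)) ` {0<..})"
    using upper by (intro bdd_aboveI2) auto
  have "?N F G \<le> (SUP \<delta>\<in>{0<..}. Inf (S \<delta>))"
  proof (rule dense_le_bounded)
    \<comment> \<open>Any negative number would do; 0 is not strictly below the norm when the
      bracket vanishes.\<close>
    show "-1 < ?N F G"
      using nonneg[of F G] by simp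
  next
    fix l assume l: "-1 < l" "l < ?N F G"
    show "l \<le> (SUP \<delta>\<in>{0<..}. Inf (S \<delta>))"
    proof (cases "0 \<le> l")
      case True
      obtain \<delta> where \<delta>: "0 < \<delta>" "\<forall>F'\<in>smooth_compact_support A. \<forall>G'\<in>smooth_compact_support A.
        C0_norm (\<lambda>q. F' q - F q) \<le> \<delta> \<longrightarrow> C0_norm (\<lambda>q. G' q - G q) \<le> \<delta> \<longrightarrow> l \<le> ?N F' G'"
        using Lp_norm_bracket_lower_semicontinuous[OF assms(3,4,2) True l(2)] by blast
      have "l \<le> Inf (S \<delta>)"
        using mem[OF \<delta>(1)] \<delta>(2) by (intro cInf_greatest) (auto simp: S_def)
      also have "\<dots> \<le> (SUP \<delta>\<in>{0<..}. Inf (S \<delta>))"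
        using \<delta>(1) by (intro cSUP_upper bdd_above) simp
      finally show ?thesis .
    next
      case False
      \<comment> \<open>Negative levels lie below every infimum; \<open>1\<close> is an arbitrary
        positive radius.\<close>
      have "0 \<le> Inf (S 1)"
        using mem[of 1] nonneg by (intro cInf_greatest) (auto simp: S_def)
      also have "\<dots> \<le> (SUP \<delta>\<in>{0<..}. Inf (S \<delta>))"
        by (intro cSUP_upper bdd_above) simp
      finally show ?thesis
        using False by simp
    qed
  qed
  moreover have "(SUP \<delta>\<in>{0<..}. Inf (S \<delta>)) \<le> ?N F G"
    using upper by (intro cSUP_least) auto
  ultimately show ?thesis
    unfolding S_def by (rule antisym[rotated])
qed

end
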